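(* Let $p\in\mathcal{P}(\mathbb{R}^n)$ with $2\le p^-$ and let $m>n$. Put $\zeta(t)=\frac2{p^-}$ if $0<t\le1$ and $\zeta(t)=\frac2{p^+}$ if $t>1$. Then there is a constant $C=C(m,p)>0$ such that for every $t>0$ and all $u,v\in L^{p(\cdot)}(\mathbb{R}^n)\cap L^2(\mathbb{R}^n)$, $$\|\eta_{t,m}*(uv)\|_{L^{p(\cdot)}(\mathbb{R}^n)\cap L^2(\mathbb{R}^n)}\le C\max\left(t^{-n\varsigma(t)},t^{-\frac n2}\right)\|u\|_{L^{p(\cdot)}(\mathbb{R}^n)\cap L^2(\mathbb{R}^n)}\|v\|_{L^{p(\cdot)}(\mathbb{R}^n)\cap L^2(\mathbb{R}^n)},$$ where (for $p^-<\infty$) $$\varsigma(t)=\begin{cases}\frac{p^-}{p^+}\left(1-\frac1{p^-}\right)+\zeta(t)\left(1-\frac{p^-}{p^+}\right), & \text{if } (0<t\le1\text{ and }2\le p^-\le3)\text{ or }\left(t>1\text{ and }1-\frac1{p^-}>\frac2{p^+}\right),\\[4pt] 1-\frac1{p^-}, & \text{if }(0<t\le1\text{ and }p^->3)\text{ or }\left(t>1\text{ and }1-\frac1{p^-}\le\frac2{p^+}\right),\end{cases}$$ and $\varsigma(t)=\zeta(t)$ if $p^-=\infty$. Moreover, if $p\in\mathcal{P}^{\log}(\mathbb{R}^n)$ with $p^-=p_\infty=2$, then there is a constant $C>0$ such that for every $t>0$ and all $u,v\in L^{p(\cdot)}(\mathbb{R}^n)$, $$\|\eta_{t,m}*(uv)\|_{L^{p(\cdot)}(\mathbb{R}^n)}\le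 C\,t^{-nK(t)}\|u\|_{L^{p(\cdot)}(\mathbb{R}^n)}\|v\|_{L^{p(\cdot)}(\mathbb{R}^n)},$$ where $$K(t)=\begin{cases}\frac1{p^+}+\zeta(t)\left(1-\frac2{p^+}\right), & \text{if } 0<t\le1\text{ or }(t>1\text{ and }p^+>4),\\[4pt] \frac12, & \text{if }t>1\text{ and }p^+\le4.\end{cases}$$
   Context: $\mathcal{P}(\mathbb{R}^n)$ is the set of measurable functions $p:\mathbb{R}^n\to[1,\infty]$; $p^-$ and $p^+$ are the essential infimum and supremum of $p$; $\frac a\infty:=0$ for finite $a$. The modular is $\varrho_{p(\cdot)}(f)=\int_{\mathbb{R}^n}\omega_{p(x)}(|f(x)|)\,dx$, with $\omega_p(t)=t^p$ if $p<\infty$, and $\omega_\infty(t)=0$ for $t\le1$, $\omega_\infty(t)=\infty$ for $t>1$. $L^{p(\cdot)}(\mathbb{R}^n)$ is the space of measurable $f$ with $\varrho_{p(\cdot)}(\lambda f)<\infty$ for some $\lambda>0$, normed by $\|f\|_{L^{p(\cdot)}}=\inf\{\lambda>0:\varrho_{p(\cdot)}(f/\lambda)\le1\}$. An intersection $X\cap Y$ carries the norm $\max\{\|f\|_X,\|f\|_Y\}$. A real function $g$ on $\mathbb{R}^n$ is globally log-Hölder continuous if there are $c>0$ and $g_\infty\in\mathbb{R}$ with $|g(x)-g(y)|\le \frac{c}{\log(e+1/|x-y|)}$ and $|g(x)-g_\infty|\le\frac{c}{\log(e+|x|)}$ for all $x,y$. $\mathcal{P}^{\log}(\mathbb{R}^n)$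 is the set of $p\in\mathcal{P}(\mathbb{R}^n)$ with $1/p$ globally log-Hölder continuous, and $p_\infty\in[1,\infty]$ is defined by $\frac1{p_\infty}=\lim_{|x|\to\infty}\frac1{p(x)}$. $\eta_{t,m}(x):=t^{-n}(1+t^{-1}|x|)^{-m}$ for $x\in\mathbb{R}^n$, $t>0$, $m>0$. *)

theory Defs
  imports "HOL-Analysis.Analysis" "HOL-Probability.Essential_Supremum"
begin

section \<open>Variable exponents\<close>

definition var_exponents :: "(real ^ 'n \<Rightarrow> ereal) set" where
  "var_exponents = {p. p \<in> borel_measurable lebesgue \<and> (\<forall>x. 1 \<le> p x)}"

definition p_minus :: "(real ^ 'n \<Rightarrow> ereal) \<Rightarrow> ereal" where
  "p_minus p = Sup {c. AE x in lebesgue. c \<le> p x}"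

definition p_plus :: "(real ^ 'n \<Rightarrow> ereal) \<Rightarrow> ereal" where
  "p_plus p = esssup lebesgue p"

text \<open>Real-valued quotients of exponents. In \<^typ>\<open>ereal\<close>, \<open>a / \<infinity> = 0\<close>, which is the
  convention used for exponents.\<close>

definition quot :: "ereal \<Rightarrow> ereal \<Rightarrow> real" where
  "quot a b = real_of_ereal (a / b)"

text \<open>For \<open>x = y\<close> the first bound reads \<open>0 \<le> c / ln (exp 1 + 1 / 0)\<close> with \<open>1 / 0 = 0\<close>, so it is
  harmless on the diagonal.\<close>

definition globally_log_Hoelder :: "(real ^ 'n \<Rightarrow> real) \<Rightarrow> bool" where
  "globally_log_Hoelder g \<longleftrightarrow>
     (\<exists>c>0. \<exists>g_inf.
        (\<forall>x y. \<bar>g x - g y\<bar> \<le> c / ln (exp 1 + 1 / norm (x - y))) \<and>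
        (\<forall>x. \<bar>g x - g_inf\<bar> \<le> c / ln (exp 1 + norm x)))"

definition log_exponents :: "(real ^ 'n \<Rightarrow> ereal) set" where
  "log_exponents = {p \<in> var_exponents. globally_log_Hoelder (\<lambda>x. quot 1 (p x))}"

text \<open>\<open>1 / p\<^sub>\<infinity> = lim 1 / p(x)\<close>; the outer quotient is taken in \<^typ>\<open>ereal\<close>, where \<open>1 / 0 = \<infinity>\<close>.
  Meaningful when the limit exists, in particular on \<open>log_exponents\<close>.\<close>

definition p_infty :: "(real ^ 'n \<Rightarrow> ereal) \<Rightarrow> ereal" where
  "p_infty p = 1 / Lim at_infinity (\<lambda>x. 1 / p x)"


section \<open>Variable Lebesgue spaces\<close>

definition omega :: "ereal \<Rightarrow> real \<Rightarrow> ennreal" where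
  "omega q t =
     (if q = \<infinity> then (if t \<le> 1 then 0 else \<infinity>) else ennreal (t powr real_of_ereal q))"

definition modular :: "(real ^ 'n \<Rightarrow> ereal) \<Rightarrow> (real ^ 'n \<Rightarrow> complex) \<Rightarrow> ennreal" where
  "modular p f = (\<integral>\<^sup>+ x. omega (p x) (norm (f x)) \<partial>lebesgue)"

text \<open>Elements are functions rather than classes modulo equality almost everywhere.\<close>

definition Lp :: "(real ^ 'n \<Rightarrow> ereal) \<Rightarrow> (real ^ 'n \<Rightarrow> complex) set" where
  "Lp p = {f \<in> borel_measurable lebesgue. \<exists>c::real. c > 0 \<and> modular p (\<lambda>x. c *\<^sub>R f x) < \<infinity>}"

text \<open>The real infimum is meaningful (over a nonempty set) on \<open>Lp p\<close>.\<close>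

definition Lp_norm :: "(real ^ 'n \<Rightarrow> ereal) \<Rightarrow> (real ^ 'n \<Rightarrow> complex) \<Rightarrow> real" where
  "Lp_norm p f = Inf {c::real. c > 0 \<and> modular p (\<lambda>x. f x /\<^sub>R c) \<le> 1}"

definition L2 :: "(real ^ 'n \<Rightarrow> complex) set" where
  "L2 = {f \<in> borel_measurable lebesgue. integrable lebesgue (\<lambda>x. (norm (f x))\<^sup>2)}"

definition L2_norm :: "(real ^ 'n \<Rightarrow> complex) \<Rightarrow> real" where
  "L2_norm f = sqrt (LINT x|lebesgue. (norm (f x))\<^sup>2)"

definition Lp_L2_norm :: "(real ^ 'n \<Rightarrow> ereal) \<Rightarrow> (real ^ 'n \<Rightarrow> complex) \<Rightarrow> real" where
  "Lp_L2_norm p f = max (Lp_norm p f) (L2_norm f)"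


section \<open>Convolution with the kernels \<open>\<eta>\<close>\<close>

definition eta :: "real \<Rightarrow> real \<Rightarrow> real ^ 'n \<Rightarrow> real" where
  "eta t m x = t powr (- real CARD('n)) * (1 + norm x / t) powr (- m)"

text \<open>The Bochner integral is 0 by convention for non-integrable functions, so existence of the
  convolution is kept as a separate predicate.\<close>

definition conv_exists :: "(real ^ 'n \<Rightarrow> real) \<Rightarrow> (real ^ 'n \<Rightarrow> complex) \<Rightarrow> bool" where
  "conv_exists k f \<longleftrightarrow> (AE x in lebesgue. integrable lebesgue (\<lambda>y. k (x - y) *\<^sub>R f y))"

definition conv :: "(real ^ 'n \<Rightarrow> real) \<Rightarrow> (real ^ 'n \<Rightarrow> complex) \<Rightarrow> real ^ 'n \<Rightarrow> complex" where
  "conv k f x = (LINT y|lebesgue. k (x - y) *\<^sub>R f y)"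


section \<open>The exponents of \<open>t\<close>\<close>

definition zeta_exp :: "(real ^ 'n \<Rightarrow> ereal) \<Rightarrow> real \<Rightarrow> real" where
  "zeta_exp p t = (if t \<le> 1 then quot 2 (p_minus p) else quot 2 (p_plus p))"

text \<open>For \<open>2 \<le> p_minus p\<close> the two cases of the definition for \<open>p_minus p < \<infinity>\<close> are complementary.\<close>

definition sigma_exp :: "(real ^ 'n \<Rightarrow> ereal) \<Rightarrow> real \<Rightarrow> real" where
  "sigma_exp p t =
     (if p_minus p = \<infinity> then zeta_exp p t
      else if t \<le> 1 \<and> 2 \<le> p_minus p \<and> p_minus p \<le> 3 \<or>
              t > 1 \<and> 1 - quot 1 (p_minus p) > quot 2 (p_plus p)
      then quot (p_minus p) (p_plus p) * (1 - quot 1 (p_minus p))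
           + zeta_exp p t * (1 - quot (p_minus p) (p_plus p))
      else 1 - quot 1 (p_minus p))"

definition K_exp :: "(real ^ 'n \<Rightarrow> ereal) \<Rightarrow> real \<Rightarrow> real" where
  "K_exp p t =
     (if t \<le> 1 \<or> t > 1 \<and> p_plus p > 4
      then quot 1 (p_plus p) + zeta_exp p t * (1 - quot 2 (p_plus p))
      else 1 / 2)"

end

theory Submission
  imports Defs
begin

text \<open>Normalize \<open>u\<close> and \<open>v\<close> and put \<open>a = p\<^sup>-\<close>, \<open>w = \<eta> * (u v)\<close>. Since \<open>\<bar>s\<bar>\<^sup>a \<le> \<bar>s\<bar>\<^sup>2 + \<omega>\<^bsub>p(x)\<^esub>(\<bar>s\<bar>)\<close>,
  the product \<open>u v\<close> is bounded in \<open>L\<^sup>1\<close> and in \<open>L\<^bsup>a/2\<^esup>\<close>. Convolution inequalities then bound \<open>w\<close> in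
  \<open>L\<^sup>\<infinity>\<close> by \<open>E t\<^bsup>-n \<zeta>(t)\<^esup>\<close> and in \<open>L\<^sup>q\<close> by \<open>E t\<^bsup>-n (1 - 1/q)\<^esup>\<close> for \<open>q = 2\<close> and \<open>q = a\<close>. Writing
  \<open>\<bar>w\<bar>\<^bsup>p(x)\<^esup> = \<bar>w\<bar>\<^sup>a \<bar>w\<bar>\<^bsup>p(x) - a\<^esup>\<close> interpolates between the exponents \<open>a\<close> and \<open>\<infinity>\<close> with parameter
  \<open>\<theta> = a / p(x) \<in> [p\<^sup>-/p\<^sup>+, 1]\<close>; the resulting power of \<open>t\<close> is affine in \<open>\<theta>\<close>, and \<open>\<sigma>(t)\<close> is its worst
  value, attained at an endpoint. In the logarithmic case, \<open>1/2 - 1/p(x) = O(1 / log \<bar>x\<bar>)\<close> makes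
  \<open>L\<^bsup>p(\<cdot>)\<^esup>\<close> embed into \<open>L\<^sup>2\<close>, so that the same argument applies.\<close>

section \<open>The kernel\<close>

lemma single_le_suminf:
  fixes h :: "nat \<Rightarrow> ennreal"
  shows "h k \<le> suminf h"
  using sum_le_suminf[of h "{k}"] by simp

text \<open>Dyadic decomposition: where \<open>1 + norm x\<close> lies between \<open>2^k\<close>
  and \<open>2^(k+1)\<close> the integrand is at most \<open>2 powr (- m * k)\<close>, and
  \<open>x\<close> lies in a ball of volume proportional to \<open>2^(k*d)\<close>. The resulting
  series is geometric with ratio \<open>2 powr (d - m) < 1\<close>.\<close>

lemma nn_integral_one_plus_norm_powr_finite:
  fixes m :: real
  assumes m: "real DIM('a::euclidean_space) < m"
  shows "(\<integral>\<^sup>+ (x::'a). ennreal ((1 + norm x) powr - m) \<partial>lborel) < \<infinity>"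
proof -
  let ?d = "DIM('a)"
  let ?V = "unit_ball_vol (real ?d)"
  let ?h = "\<lambda>(k::nat) (x::'a). ennreal (2 powr (- m * real k)) * indicator (cball 0 (2 ^ Suc k)) x"
  let ?q = "2 powr (real ?d - m)"
  have dyadic: "ennreal ((1 + norm x) powr - m) \<le> (\<Sum>k. ?h k x)" for x :: 'a
  proof -
    define k where "k = nat \<lfloor>log 2 (1 + norm x)\<rfloor>"
    have pos: "0 \<le> log 2 (1 + norm x)"
      by (subst zero_le_log_cancel_iff) (auto intro: add_pos_nonneg)
    have k: "real k \<le> log 2 (1 + norm x)" "log 2 (1 + norm x) \<le> real (Suc k)"
      using pos unfolding k_def by linarith+
    have "2 powr real k \<le> 1 + norm x"
      using k(1) by (subst (asm) le_log_iff) (auto intro: add_pos_nonneg)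
    then have "(1 + norm x) powr - m \<le> (2 powr real k) powr - m"
      using m by (intro powr_mono2') auto
    also have "\<dots> = 2 powr (- m * real k)"
      by (simp add: powr_powr mult.commute)
    finally have 1: "(1 + norm x) powr - m \<le> 2 powr (- m * real k)" .
    have "1 + norm x \<le> 2 powr real (Suc k)"
      using k(2) by (subst (asm) log_le_iff) (auto intro: add_pos_nonneg)
    then have 2: "x \<in> cball 0 (2 ^ Suc k)"
      by (subst (asm) powr_realpow) auto
    have "ennreal ((1 + norm x) powr - m) \<le> ?h k x"
      using 1 2 by (simp add: ennreal_leI)
    also have "\<dots> \<le> (\<Sum>k. ?h k x)"
      by (rule single_le_suminf[of "\<lambda>k. ?h k x" k])
    finally show ?thesis .
  qed
  have "(\<integral>\<^sup>+ (x::'a). ennreal ((1 + norm x) powr - m) \<partial>lborel) \<le> (\<integral>\<^sup>+ x. (\<Sum>k. ?h k x) \<partial>lborel)"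
    by (intro nn_integral_mono dyadic)
  also have "\<dots> = (\<Sum>k. \<integral>\<^sup>+ x. ?h k x \<partial>lborel)"
    by (rule nn_integral_suminf)
      (intro borel_measurable_times_ennreal borel_measurable_const borel_measurable_indicator, simp)
  also have "\<dots> = (\<Sum>k. ennreal ((?V * 2 ^ ?d) * ?q ^ k))"
  proof (intro suminf_cong)
    fix k :: nat
    have "(\<integral>\<^sup>+ x. ?h k x \<partial>lborel) = ennreal (2 powr (- m * real k)) * emeasure lborel (cball (0::'a) (2 ^ Suc k))"
      by (rule nn_integral_cmult_indicator) simp
    also have "\<dots> = ennreal (2 powr (- m * real k) * (?V * (2 ^ Suc k) ^ ?d))"
      by (simp add: emeasure_cball ennreal_mult' del: power_Suc)
    also have "2 powr (- m * real k) * (?V * (2 ^ Suc k) ^ ?d) = (?V * 2 ^ ?d) * ?q ^ k"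
    proof -
      have "?q ^ k = 2 powr (real k * (real ?d - m))"
        by (simp only: powr_power mult.commute)
      also have "real k * (real ?d - m) = - m * real k + real (k * ?d)"
        by (simp add: algebra_simps)
      also have "2 powr \<dots> = 2 powr (- m * real k) * 2 ^ (k * ?d)"
        by (subst powr_add, subst powr_realpow) auto
      finally show ?thesis by (simp add: power_mult_distrib power_mult)
    qed
    finally show "(\<integral>\<^sup>+ x. ?h k x \<partial>lborel) = ennreal ((?V * 2 ^ ?d) * ?q ^ k)" .
  qed
  also have "\<dots> < \<infinity>"
  proof -
    have "summable (\<lambda>k. (?V * 2 ^ ?d) * ?q ^ k)"
      using m powr_less_mono[of "real ?d - m" 0 2]
      by (intro summable_mult summable_geometric) simp
    then show ?thesis
      by (subst suminf_ennreal2) auto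
  qed
  finally show ?thesis .
qed

lemma nn_integral_lborel_translate:
  fixes F :: "'a::euclidean_space \<Rightarrow> ennreal"
  assumes [measurable]: "F \<in> borel_measurable borel"
  shows "(\<integral>\<^sup>+ x. F (x - y) \<partial>lborel) = (\<integral>\<^sup>+ x. F x \<partial>lborel)"
proof -
  have "(\<integral>\<^sup>+ x. F x \<partial>lborel) = (\<integral>\<^sup>+ x. F x \<partial>distr lborel borel ((+) (- y)))"
    by (simp add: lborel_distr_plus)
  also have "\<dots> = (\<integral>\<^sup>+ x. F (x - y) \<partial>lborel)"
    by (subst nn_integral_distr) auto
  finally show ?thesis ..
qed

lemma borel_measurable_eta [measurable]: "eta t m \<in> borel_measurable borel"
  unfolding eta_def by measurable

lemma eta_pos:
  assumes "0 < t"
  shows "0 < eta t m x"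
proof -
  have "0 < 1 + norm x / t"
    using assms by (intro add_pos_nonneg) auto
  then show ?thesis using assms by (simp add: eta_def)
qed

lemma eta_le:
  fixes x :: "real ^ 'n"
  assumes "0 < t" "0 \<le> m"
  shows "eta t m x \<le> t powr - real CARD('n)"
proof -
  have "(1 + norm x / t) powr - m \<le> 1 powr - m"
    using assms by (intro powr_mono2') auto
  then show ?thesis
    unfolding eta_def by (intro mult_left_le) auto
qed

lemma eta_minus_commute: "eta t m (x - y) = eta t m (y - x)"
  by (simp add: eta_def norm_minus_commute)

text \<open>Substitute \<open>t *\<^sub>R x\<close> for \<open>x\<close>. The mass of the kernel is
  the same for every \<open>t\<close>, which is what keeps all later constants independent of
  \<open>t\<close>.\<close>

lemma nn_integral_eta:
  assumes t: "0 < t"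
  shows "(\<integral>\<^sup>+ x. ennreal (eta t m (x::real^'n)) \<partial>lborel)
       = (\<integral>\<^sup>+ x. ennreal ((1 + norm (x::real^'n)) powr - m) \<partial>lborel)"
proof -
  have "(\<integral>\<^sup>+ x. ennreal (eta t m (x::real^'n)) \<partial>lborel)
     = (\<integral>\<^sup>+ x. ennreal (eta t m x) \<partial>density (distr lborel borel (\<lambda>x::real^'n. 0 + t *\<^sub>R x)) (\<lambda>_. \<bar>t\<bar>^DIM(real^'n)))"
    using t lborel_affine[of t "0::real^'n"] by simp
  also have "\<dots> = (\<integral>\<^sup>+ x. ennreal (t ^ CARD('n)) * ennreal (eta t m (t *\<^sub>R x)) \<partial>(lborel :: (real^'n) measure))"
    using t by (simp add: nn_integral_density nn_integral_distr)
  also have "\<dots> = (\<integral>\<^sup>+ x. ennreal ((1 + norm (x::real^'n)) powr - m) \<partial>lborel)"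
  proof (rule nn_integral_cong)
    fix x :: "real^'n"
    have "t ^ CARD('n) * eta t m (t *\<^sub>R x) = (1 + norm x) powr - m"
      using t by (simp add: eta_def powr_minus powr_realpow)
    then show "ennreal (t ^ CARD('n)) * ennreal (eta t m (t *\<^sub>R x)) = ennreal ((1 + norm x) powr - m)"
      using t by (simp add: ennreal_mult'[symmetric])
  qed
  finally show ?thesis .
qed

section \<open>Convolution with the kernel\<close>

text \<open>Elements of \<open>Lp p\<close> are only Lebesgue measurable, whereas translation and
  Fubini are applied to Borel functions over \<open>lborel\<close>; this allows passing to a Borel
  representative, built from those of the real and imaginary parts.\<close>

lemma borel_representative_complex:
  fixes f :: "'a \<Rightarrow> complex"
  assumes f: "f \<in> borel_measurable (completion M)"
  shows "\<exists>f' \<in> borel_measurable M. AE x in M. f x = f' x"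
proof -
  have "(\<lambda>x. Re (f x)) \<in> borel_measurable (completion M)" "(\<lambda>x. Im (f x)) \<in> borel_measurable (completion M)"
    using measurable_compose[OF f borel_measurable_Re] measurable_compose[OF f borel_measurable_Im]
    by simp_all
  from this[THEN completion_ex_borel_measurable_real]
  obtain a b where [measurable]: "a \<in> borel_measurable M" "b \<in> borel_measurable M"
    and ab: "AE x in M. Re (f x) = a x" "AE x in M. Im (f x) = b x"
    by auto
  have "AE x in M. f x = Complex (a x) (b x)"
    using ab by eventually_elim (simp add: complex_eq_iff)
  moreover have "(\<lambda>x. Complex (a x) (b x)) \<in> borel_measurable M"
    by (simp add: borel_measurable_complex_iff)
  ultimately show ?thesis by (intro bexI[of _ "\<lambda>x. Complex (a x) (b x)"])
qed

text \<open>All estimates of the convolution go through the nonnegative majorant. Where it is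
  finite, the Bochner integral is genuine and not the default value 0.\<close>

lemma conv_integrable_and_bound:
  fixes f :: "real ^ 'n \<Rightarrow> complex"
  assumes k [measurable]: "k \<in> borel_measurable borel" and k0: "\<And>x. 0 \<le> k x"
    and f [measurable]: "f \<in> borel_measurable borel"
    and fin: "(\<integral>\<^sup>+ y. ennreal (k (x - y)) * ennreal (norm (f y)) \<partial>lborel) < \<infinity>"
  shows "integrable lebesgue (\<lambda>y. k (x - y) *\<^sub>R f y)"
    and "ennreal (norm (conv k f x)) \<le> (\<integral>\<^sup>+ y. ennreal (k (x - y)) * ennreal (norm (f y)) \<partial>lborel)"
proof -
  have eq: "(\<integral>\<^sup>+ y. ennreal (norm (k (x - y) *\<^sub>R f y)) \<partial>lborel)
          = (\<integral>\<^sup>+ y. ennreal (k (x - y)) * ennreal (norm (f y)) \<partial>lborel)"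
    by (rule nn_integral_cong) (simp add: k0 abs_of_nonneg ennreal_mult')
  have "integrable lborel (\<lambda>y. k (x - y) *\<^sub>R f y)"
  proof (rule integrableI_bounded)
    show "(\<integral>\<^sup>+ y. ennreal (norm (k (x - y) *\<^sub>R f y)) \<partial>lborel) < \<infinity>"
      using fin unfolding eq .
  qed measurable
  moreover have "(\<lambda>y. k (x - y) *\<^sub>R f y) \<in> borel_measurable lborel"
    by measurable
  ultimately show int: "integrable lebesgue (\<lambda>y. k (x - y) *\<^sub>R f y)"
    by (simp add: integrable_completion)
  show "ennreal (norm (conv k f x)) \<le> (\<integral>\<^sup>+ y. ennreal (k (x - y)) * ennreal (norm (f y)) \<partial>lborel)"
    using integral_norm_bound_ennreal[OF int] unfolding conv_def nn_integral_completion eq .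
qed

lemma borel_measurable_conv:
  fixes f :: "real ^ 'n \<Rightarrow> complex"
  assumes [measurable]: "k \<in> borel_measurable borel" "f \<in> borel_measurable borel"
  shows "conv k f \<in> borel_measurable borel"
proof -
  have "(\<lambda>x. LINT y|lborel. k (x - y) *\<^sub>R f y) \<in> borel_measurable borel"
    by (rule lborel.borel_measurable_lebesgue_integral) measurable
  also have "(\<lambda>x. LINT y|lborel. k (x - y) *\<^sub>R f y) = conv k f"
    unfolding conv_def by (intro ext integral_completion[symmetric]) measurable
  finally show ?thesis .
qed

text \<open>A substitute for Hoelder's inequality: constants are irrelevant here, and choosing \<open>A\<close> well
  recovers the correct powers.\<close>

lemma le_powr_mult_add:
  fixes s A r :: real
  assumes "0 \<le> s" "0 < A" "1 \<le> r"
  shows "s \<le> s powr r * A powr (1 - r) + A"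
proof (cases "s \<le> A")
  case False
  then have "A powr (r - 1) \<le> s powr (r - 1)"
    using assms by (intro powr_mono2) auto
  then have "s * 1 \<le> s * (s powr (r - 1) * A powr (1 - r))"
    using assms False
    by (intro mult_left_mono) (simp_all add: powr_diff field_simps)
  also have "\<dots> = s powr r * A powr (1 - r)"
    using False assms by (simp add: powr_mult_base)
  finally show ?thesis using assms by simp
next
  case True
  have "0 \<le> s powr r * A powr (1 - r)" by simp
  then show ?thesis using True by linarith
qed

context
  fixes t m :: real and f :: "real ^ 'n \<Rightarrow> complex"
  assumes t: "0 < t" and m: "0 \<le> m" and f [measurable]: "f \<in> borel_measurable borel"
begin

text \<open>The endpoint with \<open>f\<close> integrable: the kernel is bounded by its value at the
  origin, \<open>t powr - n\<close>.\<close>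

lemma eta_majorant_le_L1:
  assumes "(\<integral>\<^sup>+ y. ennreal (norm (f y)) \<partial>lborel) \<le> ennreal D" and "0 \<le> D"
  shows "(\<integral>\<^sup>+ y. ennreal (eta t m (x - y)) * ennreal (norm (f y)) \<partial>lborel)
          \<le> ennreal (D * t powr - real CARD('n))"
proof -
  have "(\<integral>\<^sup>+ y. ennreal (eta t m (x - y)) * ennreal (norm (f y)) \<partial>lborel)
     \<le> (\<integral>\<^sup>+ y. ennreal (t powr - real CARD('n)) * ennreal (norm (f y)) \<partial>lborel)"
    using t m by (intro nn_integral_mono mult_right_mono ennreal_leI eta_le) auto
  also have "\<dots> = ennreal (t powr - real CARD('n)) * (\<integral>\<^sup>+ y. ennreal (norm (f y)) \<partial>lborel)"
    by (simp add: nn_integral_cmult)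
  also have "\<dots> \<le> ennreal (t powr - real CARD('n)) * ennreal D"
    using assms by (intro mult_left_mono) auto
  finally show ?thesis using assms(2) by (simp add: ennreal_mult' mult.commute)
qed

lemma nn_integral_eta_reflect:
  "(\<integral>\<^sup>+ y. ennreal (eta t m (x - y)) \<partial>lborel) = (\<integral>\<^sup>+ y. ennreal (eta t m (y::real^'n)) \<partial>lborel)"
  for x :: "real ^ 'n"
  by (subst eta_minus_commute, subst nn_integral_lborel_translate[where F = "\<lambda>x. ennreal (eta t m x)"]) auto

text \<open>The opposite endpoint, with \<open>f\<close> bounded and the kernel integrable; it
  serves the case where the exponent is infinite almost everywhere.\<close>

lemma eta_majorant_le_bounded:
  assumes C1: "(\<integral>\<^sup>+ y. ennreal (eta t m (y::real^'n)) \<partial>lborel) \<le> ennreal C1"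
    and "AE y in lborel. norm (f y) \<le> 1"
  shows "(\<integral>\<^sup>+ y. ennreal (eta t m (x - y)) * ennreal (norm (f y)) \<partial>lborel) \<le> ennreal C1"
proof -
  have "(\<integral>\<^sup>+ y. ennreal (eta t m (x - y)) * ennreal (norm (f y)) \<partial>lborel)
     \<le> (\<integral>\<^sup>+ y. ennreal (eta t m (x - y)) \<partial>lborel)"
    using assms(2)
    by (intro nn_integral_mono_AE) (auto elim!: eventually_mono simp: mult_left_le)
  then show ?thesis
    using C1 by (simp add: nn_integral_eta_reflect)
qed

text \<open>Hoelder's inequality up to a constant. Apply \<open>le_powr_mult_add\<close> to
  \<open>norm (f y)\<close> with \<open>A = t powr (- n / r)\<close>: this choice balances the two
  terms, because \<open>A powr (1 - r) * t powr - n = A\<close>.\<close>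

lemma eta_majorant_le_Lr:
  assumes C1: "(\<integral>\<^sup>+ y. ennreal (eta t m (y::real^'n)) \<partial>lborel) \<le> ennreal C1" "0 \<le> C1"
    and D: "(\<integral>\<^sup>+ y. ennreal (norm (f y) powr r) \<partial>lborel) \<le> ennreal D" "0 \<le> D" and r: "1 \<le> r"
  shows "(\<integral>\<^sup>+ y. ennreal (eta t m (x - y)) * ennreal (norm (f y)) \<partial>lborel)
          \<le> ennreal ((D + C1) * t powr (- real CARD('n) / r))"
proof -
  let ?N = "real CARD('n)"
  define A where "A = t powr (- ?N / r)"
  have A: "0 < A" using t by (simp add: A_def)
  define c where "c = A powr (1 - r) * t powr - ?N"
  have c: "c = A" "0 \<le> c"
    using t r by (simp_all add: A_def c_def powr_powr powr_add[symmetric] field_simps)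
  have "(\<integral>\<^sup>+ y. ennreal (eta t m (x - y)) * ennreal (norm (f y)) \<partial>lborel)
     \<le> (\<integral>\<^sup>+ y. ennreal c * ennreal (norm (f y) powr r) + ennreal A * ennreal (eta t m (x - y)) \<partial>lborel)"
  proof (rule nn_integral_mono)
    fix y
    have e: "0 \<le> eta t m (x - y)" "eta t m (x - y) \<le> t powr - ?N"
      using eta_pos[OF t] eta_le[OF t m] by (auto intro: less_imp_le)
    have "eta t m (x - y) * norm (f y)
       \<le> eta t m (x - y) * (norm (f y) powr r * A powr (1 - r) + A)"
      using A r e by (intro mult_left_mono le_powr_mult_add) auto
    also have "\<dots> \<le> c * norm (f y) powr r + A * eta t m (x - y)"
      using mult_right_mono[OF e(2), of "norm (f y) powr r * A powr (1 - r)"]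
      by (simp add: c_def algebra_simps)
    finally show "ennreal (eta t m (x - y)) * ennreal (norm (f y))
       \<le> ennreal c * ennreal (norm (f y) powr r) + ennreal A * ennreal (eta t m (x - y))"
      using e A c by (simp add: ennreal_mult[symmetric] ennreal_plus[symmetric] ennreal_leI del: ennreal_plus)
  qed
  also have "\<dots> = ennreal c * (\<integral>\<^sup>+ y. ennreal (norm (f y) powr r) \<partial>lborel)
                + ennreal A * (\<integral>\<^sup>+ y. ennreal (eta t m (x - y)) \<partial>lborel)"
    by (simp add: nn_integral_add nn_integral_cmult)
  also have "\<dots> \<le> ennreal c * ennreal D + ennreal A * ennreal C1"
    unfolding nn_integral_eta_reflect using D C1 by (intro add_mono mult_left_mono) auto
  also have "\<dots> = ennreal ((D + C1) * t powr (- ?N / r))"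
    using A D(2) C1(2) unfolding c(1) A_def[symmetric]
    by (simp add: ennreal_mult[symmetric] ennreal_plus[symmetric] algebra_simps del: ennreal_plus)
  finally show ?thesis .
qed

text \<open>Young's convolution inequality up to a constant: with \<open>A = \<bar>w\<bar> / (2 D)\<close> the error term in
  \<open>\<eta> \<le> \<eta>\<^sup>q A\<^sup>1\<^sup>-\<^sup>q + A\<close> integrates to half of the left-hand side and is absorbed.\<close>

lemma nn_integral_conv_powr_le:
  assumes C1: "(\<integral>\<^sup>+ y. ennreal (eta t m (y::real^'n)) \<partial>lborel) \<le> ennreal C1" "0 \<le> C1"
    and D: "(\<integral>\<^sup>+ y. ennreal (norm (f y)) \<partial>lborel) \<le> ennreal D" "0 < D" and q: "1 \<le> q"
  shows "(\<integral>\<^sup>+ x. ennreal (norm (conv (eta t m) f x) powr q) \<partial>lborel)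
          \<le> ennreal ((2 * D) powr q * C1 * t powr (- real CARD('n) * (q - 1)))"
proof -
  let ?N = "real CARD('n)"
  define H where "H x = (\<integral>\<^sup>+ y. ennreal (eta t m (x - y) powr q) * ennreal (norm (f y)) \<partial>lborel)" for x
  define w where "w x = norm (conv (eta t m) f x)" for x
  have pointwise: "ennreal (w x powr q) \<le> ennreal ((2 * D) powr q / D) * H x" for x
  \<comment> \<open>The choice of \<open>A\<close> below needs \<open>w x\<close> positive, and the
    absorption needs \<open>H x\<close> finite. In the excluded cases the left side is 0 or the
    right side is infinite.\<close>
  proof (cases "w x = 0 \<or> H x = \<infinity>")
    case True
    then show ?thesis using D by (auto simp: ennreal_mult_top)
  next
    case False
    then obtain h where h: "H x = ennreal h" "0 \<le> h" by (cases "H x") auto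
    have w: "0 < w x" using False by (simp add: w_def)
    define A where "A = w x / (2 * D)"
    have A: "0 < A" using w D by (simp add: A_def)
    have "ennreal (w x) \<le> (\<integral>\<^sup>+ y. ennreal (eta t m (x - y)) * ennreal (norm (f y)) \<partial>lborel)"
      unfolding w_def
    proof (rule conv_integrable_and_bound)
      show "(\<integral>\<^sup>+ y. ennreal (eta t m (x - y)) * ennreal (norm (f y)) \<partial>lborel) < \<infinity>"
        using eta_majorant_le_L1[OF D(1), of x] D(2) by (simp add: le_less_trans)
    qed (use eta_pos[OF t] in \<open>auto intro: less_imp_le\<close>)
    also have "\<dots> \<le> (\<integral>\<^sup>+ y. ennreal (A powr (1 - q)) * (ennreal (eta t m (x - y) powr q) * ennreal (norm (f y)))
                    + ennreal A * ennreal (norm (f y)) \<partial>lborel)"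
    proof (rule nn_integral_mono)
      fix y
      have e: "0 \<le> eta t m (x - y)"
        using eta_pos[OF t] by (auto intro: less_imp_le)
      have "eta t m (x - y) * norm (f y)
         \<le> (eta t m (x - y) powr q * A powr (1 - q) + A) * norm (f y)"
        using A q e by (intro mult_right_mono le_powr_mult_add) auto
      then have "eta t m (x - y) * norm (f y)
         \<le> A powr (1 - q) * (eta t m (x - y) powr q * norm (f y)) + A * norm (f y)"
        by (simp add: algebra_simps)
      then show "ennreal (eta t m (x - y)) * ennreal (norm (f y))
         \<le> ennreal (A powr (1 - q)) * (ennreal (eta t m (x - y) powr q) * ennreal (norm (f y)))
           + ennreal A * ennreal (norm (f y))"
        using e A by (simp add: ennreal_mult[symmetric] ennreal_plus[symmetric] ennreal_leI del: ennreal_plus)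
    qed
    also have "\<dots> = ennreal (A powr (1 - q)) * H x + ennreal A * (\<integral>\<^sup>+ y. ennreal (norm (f y)) \<partial>lborel)"
      unfolding H_def by (simp add: nn_integral_add nn_integral_cmult)
    also have "\<dots> \<le> ennreal (A powr (1 - q)) * ennreal h + ennreal A * ennreal D"
      unfolding h using D by (intro add_mono mult_left_mono) auto
    also have "\<dots> = ennreal (A powr (1 - q) * h + A * D)"
      using A h D by (simp add: ennreal_mult)
    finally have "w x \<le> A powr (1 - q) * h + A * D"
      using A h D by (subst (asm) ennreal_le_iff) auto
    then have "D * A \<le> A powr (1 - q) * h"
      using D by (simp add: A_def field_simps)
    then have "D * A * A powr (q - 1) \<le> A powr (1 - q) * h * A powr (q - 1)"
      by (intro mult_right_mono) auto
    then have "D * A powr q \<le> h"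
      using A by (simp add: powr_diff field_simps)
    moreover have "w x powr q = (2 * D) powr q * A powr q"
      using D w by (simp add: A_def powr_mult[symmetric])
    ultimately have "w x powr q \<le> (2 * D) powr q / D * h"
      using D by (simp add: field_simps mult_left_mono)
    then show ?thesis
      using D h by (simp add: ennreal_mult[symmetric] ennreal_leI)
  qed
  \<comment> \<open>By Fubini and translation the integral of \<open>H\<close> factors. The power
    \<open>q\<close> of the kernel then reduces to its mass: one factor is kept and the remaining
    \<open>q - 1\<close> are bounded by \<open>t powr - n\<close>.\<close>
  have "(\<integral>\<^sup>+ x. H x \<partial>lborel)
      = (\<integral>\<^sup>+ y. (\<integral>\<^sup>+ x. ennreal (eta t m (x - y) powr q) * ennreal (norm (f y)) \<partial>lborel) \<partial>lborel)"
    unfolding H_def by (intro lborel_pair.Fubini') measurable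
  also have "\<dots> = (\<integral>\<^sup>+ y. (\<integral>\<^sup>+ x. ennreal (eta t m (x::real^'n) powr q) \<partial>lborel) * ennreal (norm (f y)) \<partial>lborel)"
    by (intro nn_integral_cong)
      (simp add: nn_integral_multc nn_integral_lborel_translate[where F = "\<lambda>x. ennreal (eta t m x powr q)"])
  also have "\<dots> \<le> (\<integral>\<^sup>+ y. ennreal (t powr (- ?N * (q - 1)) * C1) * ennreal (norm (f y)) \<partial>lborel)"
  proof (intro nn_integral_mono mult_right_mono)
    have "(\<integral>\<^sup>+ x. ennreal (eta t m (x::real^'n) powr q) \<partial>lborel)
       \<le> (\<integral>\<^sup>+ x. ennreal (t powr (- ?N * (q - 1))) * ennreal (eta t m (x::real^'n)) \<partial>lborel)"
    proof (rule nn_integral_mono)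
      fix x :: "real^'n"
      have e: "0 < eta t m x" by (rule eta_pos[OF t])
      have "eta t m x powr q = eta t m x * eta t m x powr (q - 1)"
        using e by (simp add: powr_mult_base)
      also have "\<dots> \<le> eta t m x * (t powr - ?N) powr (q - 1)"
        using e q eta_le[OF t m, of x] by (intro mult_left_mono powr_mono2) auto
      finally show "ennreal (eta t m x powr q) \<le> ennreal (t powr (- ?N * (q - 1))) * ennreal (eta t m x)"
        using e by (simp add: ennreal_mult[symmetric] ennreal_leI powr_powr mult.commute)
    qed
    also have "\<dots> = ennreal (t powr (- ?N * (q - 1))) * (\<integral>\<^sup>+ x. ennreal (eta t m (x::real^'n)) \<partial>lborel)"
      by (simp add: nn_integral_cmult)
    also have "\<dots> \<le> ennreal (t powr (- ?N * (q - 1))) * ennreal C1"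
      using C1 by (intro mult_left_mono) auto
    finally show "(\<integral>\<^sup>+ x. ennreal (eta t m (x::real^'n) powr q) \<partial>lborel) \<le> ennreal (t powr (- ?N * (q - 1)) * C1)"
      using C1 by (simp add: ennreal_mult)
  qed simp
  also have "\<dots> = ennreal (t powr (- ?N * (q - 1)) * C1) * (\<integral>\<^sup>+ y. ennreal (norm (f y)) \<partial>lborel)"
    by (simp add: nn_integral_cmult)
  also have "\<dots> \<le> ennreal (t powr (- ?N * (q - 1)) * C1) * ennreal D"
    using D by (intro mult_left_mono) auto
  finally have H: "(\<integral>\<^sup>+ x. H x \<partial>lborel) \<le> ennreal (t powr (- ?N * (q - 1)) * C1 * D)"
    using C1 D by (simp add: ennreal_mult)
  have [measurable]: "H \<in> borel_measurable borel"
    unfolding H_def by (rule lborel.borel_measurable_nn_integral) measurable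
  have "(\<integral>\<^sup>+ x. ennreal (w x powr q) \<partial>lborel) \<le> (\<integral>\<^sup>+ x. ennreal ((2 * D) powr q / D) * H x \<partial>lborel)"
    by (intro nn_integral_mono pointwise)
  also have "\<dots> = ennreal ((2 * D) powr q / D) * (\<integral>\<^sup>+ x. H x \<partial>lborel)"
    by (simp add: nn_integral_cmult)
  also have "\<dots> \<le> ennreal ((2 * D) powr q / D) * ennreal (t powr (- ?N * (q - 1)) * C1 * D)"
    using H by (intro mult_left_mono) auto
  also have "\<dots> = ennreal ((2 * D) powr q * C1 * t powr (- ?N * (q - 1)))"
    using D C1 by (simp add: ennreal_mult[symmetric] field_simps)
  finally show ?thesis unfolding w_def .
qed

end

section \<open>Variable exponents and modulars\<close>

lemma var_exponents_measurable: "p \<in> var_exponents \<Longrightarrow> p \<in> borel_measurable lebesgue"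
  and var_exponents_ge_1: "p \<in> var_exponents \<Longrightarrow> 1 \<le> p x"
  by (auto simp: var_exponents_def)

text \<open>The set of lower bounds may be uncountable, so its supremum is approached along a
  sequence; countably many null sets can be discarded together.\<close>

lemma AE_p_minus_le: "AE x in lebesgue. p_minus p \<le> p x"
proof -
  let ?S = "{c. AE x in lebesgue. c \<le> p x}"
  have "- \<infinity> \<in> ?S" by simp
  then obtain c :: "nat \<Rightarrow> ereal" where c: "range c \<subseteq> ?S" "Sup ?S = (SUP i. c i)"
    using Sup_countable_SUP[of ?S] by blast
  have "AE x in lebesgue. \<forall>i. c i \<le> p x"
    using c(1) by (subst AE_all_countable) auto
  then show ?thesis
    unfolding p_minus_def c(2) by eventually_elim (auto intro: SUP_least)
qed

lemma p_minus_le_p_plus: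
  fixes p :: "real ^ 'a \<Rightarrow> ereal"
  shows "p_minus p \<le> p_plus p"
proof -
  have "AE x in lebesgue. p_minus p \<le> p x \<and> p x \<le> p_plus p"
    using AE_p_minus_le[of p] esssup_AE[of p lebesgue] unfolding p_plus_def
    by (rule AE_conjI)
  \<comment> \<open>The whole space is not a null set, so a property valid almost everywhere holds
    at some point.\<close>
  moreover have "ae_filter (lebesgue :: (real ^ 'a) measure) \<noteq> bot"
    by (simp add: ae_filter_eq_bot_iff)
  ultimately obtain x where "p_minus p \<le> p x \<and> p x \<le> p_plus p"
    using eventually_happens'[of "ae_filter lebesgue" "\<lambda>x. p_minus p \<le> p x \<and> p x \<le> p_plus p"]
    by auto
  then show ?thesis by auto
qed

lemma quot_ereal [simp]: "r \<noteq> 0 \<Longrightarrow> quot (ereal s) (ereal r) = s / r"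
  by (simp add: quot_def)

lemma quot_infinity [simp]: "quot (ereal s) \<infinity> = 0"
  by (simp add: quot_def)

lemma quot_one [simp]: "r \<noteq> 0 \<Longrightarrow> quot 1 (ereal r) = 1 / r" "quot 1 \<infinity> = 0"
  using quot_ereal[of r 1] quot_infinity[of 1] by (simp_all add: one_ereal_def)

lemma quot_two [simp]: "r \<noteq> 0 \<Longrightarrow> quot 2 (ereal r) = 2 / r" "quot 2 \<infinity> = 0"
  using quot_ereal[of r 2] quot_infinity[of 2] by (simp_all add: numeral_eq_ereal)

section \<open>The modular under monotonicity and scaling\<close>

lemma borel_measurable_omega:
  assumes [measurable]: "p \<in> borel_measurable M" "f \<in> borel_measurable M"
  shows "(\<lambda>x. omega (p x) (f x)) \<in> borel_measurable M"
  unfolding omega_def by measurable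

lemma omega_mono:
  assumes "1 \<le> q" "0 \<le> s" "s \<le> r"
  shows "omega q s \<le> omega q r"
proof (cases "q = \<infinity>")
  case False
  then have "0 \<le> real_of_ereal q"
    using assms(1) by (cases q) auto
  then show ?thesis
    using False assms by (simp add: omega_def ennreal_leI powr_mono2)
qed (use assms in \<open>auto simp: omega_def\<close>)

text \<open>For finite exponents \<open>r\<close> this is \<open>k \<le> k powr r\<close>, valid
  since \<open>1 \<le> r\<close>. For \<open>q = \<infinity>\<close> the right side is infinite as
  soon as \<open>s > 1\<close>, and the left side vanishes otherwise.\<close>

lemma omega_divide_le:
  assumes "1 \<le> q" "0 \<le> s" "1 \<le> k"
  shows "omega q (s / k) \<le> ennreal (1 / k) * omega q s"
proof (cases q)
  case (real r)
  then have r: "1 \<le> r" using assms by simp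
  have "k powr 1 \<le> k powr r"
    using assms r by (intro powr_mono) auto
  then have "(s / k) powr r \<le> 1 / k * s powr r"
    using assms by (simp add: powr_divide divide_left_mono)
  then show ?thesis
    using real assms by (simp add: omega_def ennreal_mult[symmetric] ennreal_leI del: times_divide_eq_left)
next
  case PInf
  then show ?thesis
    using assms by (auto simp: omega_def divide_le_eq ennreal_mult_top)
qed (use assms in auto)

lemma modular_divide_le:
  assumes p: "p \<in> var_exponents" and f: "f \<in> borel_measurable lebesgue" and k: "1 \<le> k"
  shows "modular p (\<lambda>x. f x /\<^sub>R k) \<le> ennreal (1 / k) * modular p f"
proof -
  have "modular p (\<lambda>x. f x /\<^sub>R k) \<le> (\<integral>\<^sup>+ x. ennreal (1 / k) * omega (p x) (norm (f x)) \<partial>lebesgue)"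
    unfolding modular_def
  proof (rule nn_integral_mono)
    fix x
    have "norm (f x /\<^sub>R k) = norm (f x) / k"
      using k by (simp add: divide_inverse)
    then show "omega (p x) (norm (f x /\<^sub>R k)) \<le> ennreal (1 / k) * omega (p x) (norm (f x))"
      using omega_divide_le[OF var_exponents_ge_1[OF p] _ k] by simp
  qed
  also have "\<dots> = ennreal (1 / k) * modular p f"
    unfolding modular_def
    using p f by (intro nn_integral_cmult borel_measurable_omega var_exponents_measurable) auto
  finally show ?thesis .
qed

lemma modular_mono:
  assumes "p \<in> var_exponents" and "\<And>x. norm (f x) \<le> norm (g x)"
  shows "modular p f \<le> modular p g"
  unfolding modular_def
  using assms by (intro nn_integral_mono omega_mono var_exponents_ge_1) auto

text \<open>Shows that the set in the definition of \<open>Lp_norm\<close> is nonempty. If the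
  modular of \<open>d *\<^sub>R f\<close> is \<open>M\<close>, a further division by
  \<open>max 1 M\<close> brings it below 1.\<close>

lemma ex_modular_le_1:
  assumes p: "p \<in> var_exponents" and f: "f \<in> Lp p"
  shows "\<exists>c>0. modular p (\<lambda>x. f x /\<^sub>R c) \<le> 1"
proof -
  obtain d :: real where d: "0 < d" "modular p (\<lambda>x. d *\<^sub>R f x) < \<infinity>"
    and [measurable]: "f \<in> borel_measurable lebesgue"
    using f by (auto simp: Lp_def)
  define M where "M = enn2real (modular p (\<lambda>x. d *\<^sub>R f x))"
  have M: "modular p (\<lambda>x. d *\<^sub>R f x) = ennreal M" "0 \<le> M"
    using d by (auto simp: M_def)
  define k where "k = max 1 M"
  have k: "1 \<le> k" "M \<le> k" by (auto simp: k_def)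
  have "modular p (\<lambda>x. (d *\<^sub>R f x) /\<^sub>R k) \<le> ennreal (1 / k) * modular p (\<lambda>x. d *\<^sub>R f x)"
    using p k by (intro modular_divide_le) measurable
  also have "\<dots> = ennreal (M / k)"
    using k M by (simp add: ennreal_mult[symmetric])
  also have "\<dots> \<le> 1"
    using k M by (simp add: ennreal_le_1)
  also have "(\<lambda>x. (d *\<^sub>R f x) /\<^sub>R k) = (\<lambda>x. f x /\<^sub>R (k / d))"
    using d k by (simp add: divide_inverse mult.commute)
  finally show ?thesis
    using d k by (intro exI[of _ "k / d"]) auto
qed

section \<open>Norm bounds and modular bounds\<close>

lemma bdd_below_Lp_norm: "bdd_below {c::real. 0 < c \<and> P c}"
  by (rule bdd_belowI[of _ 0]) auto

lemma Lp_norm_nonneg: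
  assumes "p \<in> var_exponents" "f \<in> Lp p"
  shows "0 \<le> Lp_norm p f"
  unfolding Lp_norm_def using ex_modular_le_1[OF assms] by (intro cInf_greatest) auto

text \<open>With a strict inequality it suffices to pick an admissible \<open>c\<close> below
  \<open>U\<close>; that the infimum is attained need not be shown, and
  \<open>Lp_norm p f = 0\<close> requires no special treatment.\<close>

lemma modular_le_1_if_Lp_norm_less:
  assumes p: "p \<in> var_exponents" and f: "f \<in> Lp p" and U: "Lp_norm p f < U"
  shows "modular p (\<lambda>x. f x /\<^sub>R U) \<le> 1"
proof -
  have "{c. 0 < c \<and> modular p (\<lambda>x. f x /\<^sub>R c) \<le> 1} \<noteq> {}"
    using ex_modular_le_1[OF p f] by auto
  from cInf_lessD[OF this U[unfolded Lp_norm_def]]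
  obtain c where c: "0 < c" "c < U" "modular p (\<lambda>x. f x /\<^sub>R c) \<le> 1"
    by auto
  have "modular p (\<lambda>x. f x /\<^sub>R U) \<le> modular p (\<lambda>x. f x /\<^sub>R c)"
    using c by (intro modular_mono[OF p]) (auto intro!: mult_right_mono le_imp_inverse_le)
  then show ?thesis using c(3) by (rule order_trans)
qed

lemma Lp_norm_le:
  assumes "0 < c" "modular p (\<lambda>x. f x /\<^sub>R c) \<le> 1"
  shows "Lp_norm p f \<le> c"
  unfolding Lp_norm_def using assms by (intro cInf_lower bdd_below_Lp_norm) auto

lemma Lp_memI:
  assumes "f \<in> borel_measurable lebesgue" "0 < c" "modular p (\<lambda>x. f x /\<^sub>R c) \<le> 1"
  shows "f \<in> Lp p"
proof -
  have "modular p (\<lambda>x. inverse c *\<^sub>R f x) < \<infinity>"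
    using assms(3) by (simp add: le_less_trans[OF _ ennreal_one_less_top])
  then show ?thesis
    unfolding Lp_def using assms by (auto intro!: exI[of _ "inverse c"])
qed

lemma L2_norm_nonneg: "0 \<le> L2_norm f"
  by (simp add: L2_norm_def)

lemma nn_integral_le_1_if_L2_norm_less:
  assumes f: "f \<in> L2" and U: "L2_norm f < U"
  shows "(\<integral>\<^sup>+ x. ennreal ((norm (f x /\<^sub>R U))\<^sup>2) \<partial>lebesgue) \<le> 1"
proof -
  have U0: "0 < U" using L2_norm_nonneg[of f] U by linarith
  let ?I = "LINT x|lebesgue. (norm (f x))\<^sup>2"
  have I: "0 \<le> ?I" by simp
  have int: "integrable lebesgue (\<lambda>x. (norm (f x))\<^sup>2)"
    using f by (simp add: L2_def)
  have sq: "(norm (f x /\<^sub>R U))\<^sup>2 = (norm (f x))\<^sup>2 / U\<^sup>2" for x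
    using U0 by (simp add: divide_inverse power_mult_distrib power_inverse)
  have "(\<integral>\<^sup>+ x. ennreal ((norm (f x /\<^sub>R U))\<^sup>2) \<partial>lebesgue) = ennreal (LINT x|lebesgue. (norm (f x))\<^sup>2 / U\<^sup>2)"
    unfolding sq using int by (intro nn_integral_eq_integral) auto
  also have "\<dots> = ennreal (?I / U\<^sup>2)" by simp
  also have "?I \<le> U\<^sup>2"
    using U I real_sqrt_le_iff[of ?I "U\<^sup>2"] U0 by (simp add: L2_norm_def)
  then have "ennreal (?I / U\<^sup>2) \<le> 1"
    using U0 I by (simp add: ennreal_le_1)
  finally show ?thesis .
qed

lemma L2_memI:
  assumes f: "f \<in> borel_measurable lebesgue" and c: "0 \<le> c"
    and le: "(\<integral>\<^sup>+ x. ennreal ((norm (f x))\<^sup>2) \<partial>lebesgue) \<le> ennreal (c\<^sup>2)"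
  shows "f \<in> L2" "L2_norm f \<le> c"
proof -
  have [measurable]: "f \<in> borel_measurable lebesgue" by (rule f)
  have int: "integrable lebesgue (\<lambda>x. (norm (f x))\<^sup>2)"
  proof (rule integrableI_bounded)
    show "(\<integral>\<^sup>+ x. ennreal (norm ((norm (f x))\<^sup>2)) \<partial>lebesgue) < \<infinity>"
      using le by (simp add: le_less_trans)
  qed measurable
  then show "f \<in> L2" using f by (simp add: L2_def)
  have "ennreal (LINT x|lebesgue. (norm (f x))\<^sup>2) \<le> ennreal (c\<^sup>2)"
    using le nn_integral_eq_integral[OF int] by simp
  then have "(LINT x|lebesgue. (norm (f x))\<^sup>2) \<le> c\<^sup>2"
    by (subst (asm) ennreal_le_iff) auto
  then show "L2_norm f \<le> c"
    unfolding L2_norm_def using c by (intro real_le_lsqrt) auto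
qed

lemma powr_le_square_plus_omega:
  assumes a: "2 \<le> a" "ereal a \<le> q" and s: "0 \<le> s"
  shows "ennreal (s powr a) \<le> ennreal (s\<^sup>2) + omega q s"
\<comment> \<open>Values up to 1 are covered by the square because \<open>2 \<le> a\<close>, larger
  ones by \<open>omega\<close> because \<open>ereal a \<le> q\<close>.\<close>
proof (cases "s \<le> 1")
  case True
  have "s powr a \<le> s powr 2"
    using a s True by (intro powr_mono') auto
  also have "s powr 2 = s\<^sup>2"
    using s by simp
  finally have "ennreal (s powr a) \<le> ennreal (s\<^sup>2)" by (rule ennreal_leI)
  then show ?thesis by (rule order_trans) simp
next
  case False
  then have "ennreal (s powr a) \<le> omega q s"
    using a by (cases q) (auto simp: omega_def intro!: ennreal_leI powr_mono)
  moreover have "omega q s \<le> ennreal (s\<^sup>2) + omega q s" by simp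
  ultimately show ?thesis by (rule order_trans)
qed

text \<open>The product is at most the square of the larger factor. This replaces the Cauchy-Schwarz
  inequality for \<open>u * v\<close>, at the cost of a constant.\<close>

lemma mult_powr_le_sum:
  fixes x y r :: real
  assumes "0 \<le> x" "0 \<le> y" "0 \<le> r"
  shows "(x * y) powr r \<le> x powr (2 * r) + y powr (2 * r)"
proof -
  have *: "(x * y) powr r \<le> y powr (2 * r)" if "x \<le> y" "0 \<le> x" for x y :: real
  proof -
    have "(x * y) powr r \<le> (y powr 2) powr r"
      using that assms by (intro powr_mono2) (auto simp: power2_eq_square mult_right_mono)
    then show ?thesis by (simp only: powr_powr)
  qed
  show ?thesis
  proof (cases "x \<le> y")
    case True
    then show ?thesis using *[OF True] assms by (simp add: add_increasing)
  next
    case False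
    then have "(x * y) powr r \<le> x powr (2 * r)"
      using *[of y x] assms by (simp add: mult.commute)
    then show ?thesis by (simp add: add_increasing2)
  qed
qed

text \<open>The exponent is affine in \<open>\<theta>\<close>, with value
  \<open>zeta_exp p t\<close> at 0 and \<open>1 - 1 / a\<close> at 1, so its extremes on the given
  interval are at the endpoints. For \<open>t \<le> 1\<close> the largest value counts, and the
  slope \<open>1 - 3 / a\<close> changes sign at \<open>a = 3\<close>. For \<open>t > 1\<close> the
  smallest counts, and the slope is \<open>1 - 1 / a - quot 2 (p_plus p)\<close>. These signs are
  the case distinction in \<open>sigma_exp\<close>.\<close>

lemma t_powr_le_sigma_exp:
  assumes a: "p_minus p = ereal a" "2 \<le> a"
    and \<theta>: "quot (p_minus p) (p_plus p) \<le> \<theta>" "\<theta> \<le> 1" and t: "0 < t" and N: "0 \<le> N"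
  shows "t powr (- N * (zeta_exp p t + \<theta> * (1 - 1 / a - zeta_exp p t))) \<le> t powr (- N * sigma_exp p t)"
proof -
  let ?z = "zeta_exp p t" and ?b = "quot (p_minus p) (p_plus p)"
  define g where "g \<theta> = ?z + \<theta> * (1 - 1 / a - ?z)" for \<theta>
  have qa: "quot 1 (p_minus p) = 1 / a" using a by simp
  have pinf: "p_minus p \<noteq> \<infinity>" using a by simp
  have g1: "g 1 = 1 - 1 / a" and gb: "g ?b = ?b * (1 - 1 / a) + ?z * (1 - ?b)"
    by (simp_all add: g_def algebra_simps)
  have up: "g \<theta>1 \<le> g \<theta>2" if "(\<theta>2 - \<theta>1) * (1 - 1 / a - ?z) \<ge> 0" for \<theta>1 \<theta>2
  proof -
    have "g \<theta>2 - g \<theta>1 = (\<theta>2 - \<theta>1) * (1 - 1 / a - ?z)"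
      unfolding g_def by (simp only: left_diff_distrib)
    then show ?thesis using that by linarith
  qed
  have sigma: "sigma_exp p t = (if t \<le> 1 \<and> a \<le> 3 \<or> t > 1 \<and> 1 - 1 / a > quot 2 (p_plus p) then g ?b else g 1)"
    unfolding sigma_exp_def gb g1 qa using a pinf by simp
  show ?thesis
  proof (cases "t \<le> 1")
    case True
    then have z: "?z = 2 / a" using a by (simp add: zeta_exp_def)
    have "g \<theta> \<le> sigma_exp p t"
    proof (cases "a \<le> 3")
      case True
      then have "1 - 1 / a - ?z \<le> 0" using a z by (simp add: field_simps)
      then have "g \<theta> \<le> g ?b" using \<theta> by (intro up mult_nonpos_nonpos) auto
      then show ?thesis using True \<open>t \<le> 1\<close> by (simp add: sigma)
    next
      case False
      then have "1 - 1 / a - ?z \<ge> 0" using a z by (simp add: field_simps)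
      then have "g \<theta> \<le> g 1" using \<theta> by (intro up mult_nonneg_nonneg) auto
      then show ?thesis using False \<open>t \<le> 1\<close> by (simp add: sigma)
    qed
    then show ?thesis
      unfolding g_def[symmetric] using True t N by (intro powr_mono') (auto intro: mult_left_mono)
  next
    case False
    then have z: "?z = quot 2 (p_plus p)" by (simp add: zeta_exp_def)
    have "sigma_exp p t \<le> g \<theta>"
    proof (cases "1 - 1 / a > ?z")
      case True
      then have "g ?b \<le> g \<theta>" using \<theta> by (intro up mult_nonneg_nonneg) auto
      then show ?thesis using True False z by (simp add: sigma)
    next
      case le: False
      then have "g 1 \<le> g \<theta>" using \<theta> by (intro up mult_nonpos_nonpos) auto
      then show ?thesis using le False z by (simp add: sigma)
    qed
    then show ?thesis
      unfolding g_def[symmetric] using False t N by (intro powr_mono) (auto intro: mult_left_mono)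
  qed
qed

text \<open>Let \<open>U\<close> and \<open>V\<close> decrease to \<open>a\<close> and
  \<open>b\<close>. This recovers the bound with the norms themselves from bounds with strictly
  larger numbers, including norms equal to 0, by which one cannot divide.\<close>

lemma le_mult_of_greater:
  fixes a b c x :: real
  assumes "\<And>U V. a < U \<Longrightarrow> b < V \<Longrightarrow> x \<le> c * U * V"
  shows "x \<le> c * a * b"
proof -
  have "((\<lambda>e. c * (a + e) * (b + e)) \<longlongrightarrow> c * (a + 0) * (b + 0)) (at_right 0)"
    by (intro tendsto_intros)
  moreover have "eventually (\<lambda>e. x \<le> c * (a + e) * (b + e)) (at_right 0)"
    using assms by (auto simp: eventually_at_filter)
  ultimately show ?thesis
    using tendsto_lowerbound[OF _ _ trivial_limit_at_right_real, of "\<lambda>e. c * (a + e) * (b + e)" "c * (a + 0) * (b + 0)" 0 x]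
    by simp
qed

section \<open>Interpolation\<close>

text \<open>For each fixed \<open>x\<close> the integrands differ only on a null set of
  \<open>y\<close>, so both conclusions hold at every point and not merely almost
  everywhere.\<close>

lemma conv_cong_AE:
  fixes f g :: "real ^ 'n \<Rightarrow> complex"
  assumes k [measurable]: "k \<in> borel_measurable borel"
    and f [measurable]: "f \<in> borel_measurable lebesgue" and g [measurable]: "g \<in> borel_measurable lebesgue"
    and ae: "AE x in lebesgue. f x = g x"
  shows "integrable lebesgue (\<lambda>y. k (x - y) *\<^sub>R f y) \<longleftrightarrow> integrable lebesgue (\<lambda>y. k (x - y) *\<^sub>R g y)"
    and "conv k f x = conv k g x"
proof -
  have "(\<lambda>y. k (x - y)) \<in> borel_measurable lborel" by measurable
  then have [measurable]: "(\<lambda>y. k (x - y)) \<in> borel_measurable lebesgue" by (rule measurable_completion)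
  have ae': "AE y in lebesgue. k (x - y) *\<^sub>R f y = k (x - y) *\<^sub>R g y"
    using ae by eventually_elim simp
  have m: "(\<lambda>y. k (x - y) *\<^sub>R f y) \<in> borel_measurable lebesgue"
    "(\<lambda>y. k (x - y) *\<^sub>R g y) \<in> borel_measurable lebesgue"
    by measurable
  show "integrable lebesgue (\<lambda>y. k (x - y) *\<^sub>R f y) \<longleftrightarrow> integrable lebesgue (\<lambda>y. k (x - y) *\<^sub>R g y)"
    by (rule integrable_cong_AE[OF m ae'])
  show "conv k f x = conv k g x"
    unfolding conv_def by (rule integral_cong_AE[OF m ae'])
qed

text \<open>For a finite exponent \<open>r\<close>, keep \<open>w powr a\<close> and bound the
  remaining power \<open>r - a\<close> by the supremum bound. The number \<open>\<mu>\<close> is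
  chosen so that the factor left over does not depend on \<open>r\<close>; hence the estimate can be
  integrated over points with different exponents. An infinite exponent corresponds to
  \<open>\<theta> = 0\<close>, where \<open>L\<close> dominates the supremum bound itself.\<close>

lemma omega_interpolate:
  fixes w E t N z L :: real
  assumes a: "2 \<le> a" "ereal a \<le> q" and E: "0 < E" and t: "0 < t" and w: "0 \<le> w" "w \<le> E * t powr (- N * z)"
    and L: "\<And>\<theta>. \<theta> = quot (ereal a) q \<Longrightarrow> E * t powr (- N * (z + \<theta> * (1 - 1 / a - z))) \<le> L"
  shows "omega q (w / L) \<le> ennreal (t powr (N * (a - 1)) / E powr a * w powr a)"
proof (cases q)
  case PInf
  then have "w \<le> L" using L[of 0] w by simp
  moreover have "0 < L" using L[of 0] PInf E t by (auto intro: less_le_trans[rotated])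
  ultimately show ?thesis using PInf by (simp add: omega_def)
next
  case (real r)
  have r: "a \<le> r" using a real by simp
  define \<mu> where "\<mu> = E * t powr (- N * (z + a / r * (1 - 1 / a - z)))"
  have \<mu>: "0 < \<mu>" "\<mu> \<le> L"
    using E t L[of "a / r"] real r a by (simp_all add: \<mu>_def)
  have "(w / L) powr r \<le> (w / \<mu>) powr r"
    using w \<mu> r a by (intro powr_mono2 divide_left_mono) auto
  also have "\<dots> = w powr a * w powr (r - a) / \<mu> powr r"
    using w \<mu> by (simp add: powr_divide powr_add[symmetric])
  also have "\<dots> \<le> w powr a * (E * t powr (- N * z)) powr (r - a) / \<mu> powr r"
    using w r by (intro divide_right_mono mult_left_mono powr_mono2) auto
  also have "(E * t powr (- N * z)) powr (r - a) / \<mu> powr r = t powr (N * (a - 1)) / E powr a"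
  proof -
    have e: "- N * (z + a / r * (1 - 1 / a - z)) * r = - N * z * (r - a) - N * (a - 1)"
      using a r by (simp add: field_simps)
    have "\<mu> powr r = E powr r * t powr (- N * z * (r - a) - N * (a - 1))"
      using E t unfolding \<mu>_def e[symmetric] by (simp only: powr_mult powr_powr)
    moreover have "(E * t powr (- N * z)) powr (r - a) = E powr r / E powr a * t powr (- N * z * (r - a))"
      using E t by (simp only: powr_mult powr_powr powr_diff[of E r a])
    ultimately show ?thesis
      using E t by (simp add: powr_diff)
  qed
  then have "w powr a * (E * t powr (- N * z)) powr (r - a) / \<mu> powr r = t powr (N * (a - 1)) / E powr a * w powr a"
    by (simp only: times_divide_eq_right[symmetric] mult.commute)
  finally have "(w / L) powr r \<le> t powr (N * (a - 1)) / E powr a * w powr a" .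
  then show ?thesis
    using real by (simp add: omega_def ennreal_leI)
qed (use a in auto)

text \<open>The core estimate, shared by both halves of the theorem. They differ only in the source
  of \<open>D\<close>: it is 1 when the square norms are normalized too, and an embedding constant
  in the logarithmic case.\<close>

lemma conv_eta_product_normalized:
  fixes p :: "real ^ 'n \<Rightarrow> ereal" and u v :: "real ^ 'n \<Rightarrow> complex"
  assumes p: "p \<in> var_exponents" and p2: "2 \<le> p_minus p" and m: "0 \<le> m"
    and C1: "(\<integral>\<^sup>+ (x::real^'n). ennreal ((1 + norm x) powr - m) \<partial>lborel) \<le> ennreal C1" "0 \<le> C1"
    and D: "0 \<le> D" and t: "0 < t" and E: "E = 4 * (D + 1) * (1 + C1)"
    and u: "u \<in> borel_measurable lebesgue" "modular p u \<le> 1" "(\<integral>\<^sup>+ x. ennreal ((norm (u x))\<^sup>2) \<partial>lebesgue) \<le> ennreal D"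
    and v: "v \<in> borel_measurable lebesgue" "modular p v \<le> 1" "(\<integral>\<^sup>+ x. ennreal ((norm (v x))\<^sup>2) \<partial>lebesgue) \<le> ennreal D"
  defines "w \<equiv> conv (eta t m) (\<lambda>x. u x * v x)"
  shows "integrable lebesgue (\<lambda>y. eta t m (x - y) *\<^sub>R (u y * v y))"
    and "w \<in> borel_measurable lebesgue"
    and "modular p (\<lambda>x. w x /\<^sub>R (E * t powr (- real CARD('n) * sigma_exp p t))) \<le> 1"
    and "(\<integral>\<^sup>+ x. ennreal ((norm (w x))\<^sup>2) \<partial>lebesgue) \<le> ennreal ((E * t powr (- real CARD('n) / 2))\<^sup>2)"
proof -
  let ?N = "real CARD('n)"
  let ?D = "2 * (D + 1)"
  have [measurable]: "u \<in> borel_measurable lebesgue" "v \<in> borel_measurable lebesgue"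
    by (rule u v)+
  have p_meas: "p \<in> borel_measurable lebesgue" by (rule var_exponents_measurable[OF p])
  have uv [measurable]: "(\<lambda>x. u x * v x) \<in> borel_measurable lebesgue" by measurable
  obtain f where f: "f \<in> borel_measurable lborel" and "AE x in lborel. u x * v x = f x"
    using borel_representative_complex[OF uv] by (rule bexE)
  then have ae: "AE x in lebesgue. u x * v x = f x"
    by (intro AE_completion)
  have fb [measurable]: "f \<in> borel_measurable borel" using f by simp
  have fl: "f \<in> borel_measurable lebesgue" using f by (rule measurable_completion)
  note cong = conv_cong_AE[OF borel_measurable_eta uv fl ae]
  have w: "w = conv (eta t m) f"
    unfolding w_def by (rule ext) (rule cong(2))
  have eta1: "(\<integral>\<^sup>+ y. ennreal (eta t m (y::real^'n)) \<partial>lborel) \<le> ennreal C1"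
    using C1(1) unfolding nn_integral_eta[OF t] .
  \<comment> \<open>Naming the product makes the comparisons with \<open>E\<close> linear.\<close>
  define P where "P = D * C1"
  have "E = 4 + 4 * C1 + 4 * D + 4 * P"
    unfolding E P_def by (simp add: algebra_simps)
  moreover have "0 \<le> P" using D C1(2) by (simp add: P_def)
  ultimately have DE: "0 < ?D" "1 \<le> ?D" "?D + C1 \<le> E" "?D \<le> E" "C1 \<le> E" "0 < E" "1 \<le> E"
    using D C1(2) by auto

  \<comment> \<open>Used with \<open>r = 1\<close> for the integrability of the product and with
    \<open>r = a / 2\<close> for its higher power.\<close>
  have f_powr: "(\<integral>\<^sup>+ y. ennreal (norm (f y) powr r) \<partial>lborel)
        \<le> (\<integral>\<^sup>+ x. ennreal (norm (u x) powr (2 * r)) \<partial>lebesgue) + (\<integral>\<^sup>+ x. ennreal (norm (v x) powr (2 * r)) \<partial>lebesgue)"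
    if "0 \<le> r" for r
  proof -
    have "(\<integral>\<^sup>+ y. ennreal (norm (f y) powr r) \<partial>lborel) = (\<integral>\<^sup>+ y. ennreal (norm (f y) powr r) \<partial>lebesgue)"
      by (simp add: nn_integral_completion)
    also have "\<dots> \<le> (\<integral>\<^sup>+ x. ennreal (norm (u x) powr (2 * r)) + ennreal (norm (v x) powr (2 * r)) \<partial>lebesgue)"
    proof (rule nn_integral_mono_AE)
      show "AE x in lebesgue. ennreal (norm (f x) powr r) \<le> ennreal (norm (u x) powr (2 * r)) + ennreal (norm (v x) powr (2 * r))"
        using ae
      proof eventually_elim
        case (elim x)
        have "norm (f x) powr r \<le> norm (u x) powr (2 * r) + norm (v x) powr (2 * r)"
          unfolding elim[symmetric] norm_mult using that by (intro mult_powr_le_sum) auto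
        then show ?case
          by (simp add: ennreal_plus[symmetric] ennreal_leI del: ennreal_plus)
      qed
    qed
    also have "\<dots> = (\<integral>\<^sup>+ x. ennreal (norm (u x) powr (2 * r)) \<partial>lebesgue) + (\<integral>\<^sup>+ x. ennreal (norm (v x) powr (2 * r)) \<partial>lebesgue)"
      by (rule nn_integral_add) measurable
    finally show ?thesis .
  qed
  have sq: "norm z powr (2 * 1) = (norm z)\<^sup>2" for z :: complex by simp
  have f1: "(\<integral>\<^sup>+ y. ennreal (norm (f y)) \<partial>lborel) \<le> ennreal ?D"
  proof -
    have "(\<integral>\<^sup>+ y. ennreal (norm (f y)) \<partial>lborel) = (\<integral>\<^sup>+ y. ennreal (norm (f y) powr 1) \<partial>lborel)" by simp
    also have "\<dots> \<le> (\<integral>\<^sup>+ x. ennreal ((norm (u x))\<^sup>2) \<partial>lebesgue) + (\<integral>\<^sup>+ x. ennreal ((norm (v x))\<^sup>2) \<partial>lebesgue)"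
      using f_powr[of 1] unfolding sq by simp
    also have "\<dots> \<le> ennreal D + ennreal D" by (intro add_mono u v)
    also have "\<dots> \<le> ennreal ?D" using D by (simp add: ennreal_plus[symmetric] ennreal_leI del: ennreal_plus)
    finally show ?thesis .
  qed
  have maj: "(\<integral>\<^sup>+ y. ennreal (eta t m (x - y)) * ennreal (norm (f y)) \<partial>lborel) \<le> ennreal (?D * t powr - ?N)" for x
    using eta_majorant_le_L1[OF t m fb f1] DE by simp
  then have maj_fin: "(\<integral>\<^sup>+ y. ennreal (eta t m (x - y)) * ennreal (norm (f y)) \<partial>lborel) < \<infinity>" for x
    by (rule le_less_trans) simp
  have eta0: "0 \<le> eta t m x" for x :: "real^'n" using eta_pos[OF t, of m x] by simp
  note pt = conv_integrable_and_bound[OF borel_measurable_eta eta0 fb maj_fin]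
  show "integrable lebesgue (\<lambda>y. eta t m (x - y) *\<^sub>R (u y * v y))"
    unfolding cong(1) by (rule pt(1))
  have wb: "w \<in> borel_measurable borel"
    unfolding w by (intro borel_measurable_conv) auto
  then show wl: "w \<in> borel_measurable lebesgue"
    by (intro measurable_completion) simp
  have w_le: "norm (w x) \<le> c"
    if "(\<integral>\<^sup>+ y. ennreal (eta t m (x - y)) * ennreal (norm (f y)) \<partial>lborel) \<le> ennreal c" "0 \<le> c" for x c
    using order_trans[OF pt(2) that(1)] that(2) unfolding w by (subst (asm) ennreal_le_iff) auto
  have w_powr: "(\<integral>\<^sup>+ x. ennreal (norm (w x) powr q) \<partial>lebesgue) \<le> ennreal (E powr q * t powr (- ?N * (q - 1)))"
    if q: "1 \<le> q" for q
  proof -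
    \<comment> \<open>This explains the shape of \<open>E\<close>, which equals
      \<open>2 * ?D * (1 + C1)\<close>: since \<open>C1\<close> is at most
      \<open>(1 + C1) powr q\<close>, one constant works for all \<open>q \<ge> 1\<close>.\<close>
    have "(2 * ?D) powr q * C1 \<le> (2 * ?D) powr q * (1 + C1) powr q"
      using C1(2) q powr_mono[of 1 q "1 + C1"] by (intro mult_left_mono) auto
    also have "\<dots> = E powr q"
      using DE C1(2) by (simp add: E powr_mult[symmetric])
    finally have "(2 * ?D) powr q * C1 * t powr (- ?N * (q - 1)) \<le> E powr q * t powr (- ?N * (q - 1))"
      by (rule mult_right_mono) simp
    from order_trans[OF nn_integral_conv_powr_le[OF t m fb eta1 C1(2) f1 DE(1) q] ennreal_leI[OF this]]
    show ?thesis
      unfolding nn_integral_completion w .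
  qed
  show "(\<integral>\<^sup>+ x. ennreal ((norm (w x))\<^sup>2) \<partial>lebesgue) \<le> ennreal ((E * t powr (- ?N / 2))\<^sup>2)"
  proof -
    have "E powr 2 * t powr (- ?N * (2 - 1)) = (E * t powr (- ?N / 2))\<^sup>2"
      using DE by (simp add: power_mult_distrib power2_eq_square powr_add[symmetric])
    then show ?thesis
      using w_powr[of 2] by simp
  qed
  define L where "L = E * t powr (- ?N * sigma_exp p t)"
  have L: "0 < L" using DE t by (simp add: L_def)
  have norm_div: "norm (w x /\<^sub>R L) = norm (w x) / L" for x
    using L by (simp add: divide_inverse)
  have "modular p (\<lambda>x. w x /\<^sub>R L) \<le> 1"
  proof (cases "p_minus p")
    \<comment> \<open>The exponent is infinite almost everywhere, so a modular at most 1 forces the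
      function to be bounded by 1 almost everywhere. The claim becomes a supremum bound without any
      power of \<open>t\<close>.\<close>
    case PInf
    have pinf: "AE x in lebesgue. p x = \<infinity>"
      using AE_p_minus_le[of p] unfolding PInf by eventually_elim simp
    have "p_plus p = \<infinity>" using p_minus_le_p_plus[of p] PInf by simp
    then have "sigma_exp p t = 0"
      using PInf by (simp add: sigma_exp_def zeta_exp_def)
    then have LE: "L = E" using t by (simp add: L_def)
    have bdd: "AE x in lebesgue. norm (g x) \<le> 1"
      if g: "g \<in> borel_measurable lebesgue" "modular p g \<le> 1" for g :: "real^'n \<Rightarrow> complex"
    proof -
      have "AE x in lebesgue. omega (p x) (norm (g x)) \<noteq> \<infinity>"
      proof (rule nn_integral_PInf_AE)
        show "(\<lambda>x. omega (p x) (norm (g x))) \<in> borel_measurable lebesgue"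
          using p_meas g by (intro borel_measurable_omega) auto
        show "(\<integral>\<^sup>+ x. omega (p x) (norm (g x)) \<partial>lebesgue) \<noteq> \<infinity>"
          using le_less_trans[OF g(2) ennreal_one_less_top] unfolding modular_def[symmetric] by simp
      qed
      with pinf show ?thesis
        by eventually_elim (auto simp: omega_def split: if_splits)
    qed
    have "AE x in lebesgue. norm (f x) \<le> 1"
      using ae bdd[OF u(1,2)] bdd[OF v(1,2)]
    proof eventually_elim
      case (elim x)
      have "norm (u x) * norm (v x) \<le> 1 * 1"
        using elim by (intro mult_mono) auto
      then show ?case unfolding elim(1)[symmetric] by (simp add: norm_mult)
    qed
    then have "AE x in lborel. norm (f x) \<le> 1"
      by (simp add: AE_completion_iff)
    then have "norm (w x) \<le> C1" for x
      using eta_majorant_le_bounded[OF t m fb eta1] C1(2) by (intro w_le)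
    from order_trans[OF this DE(5)] have "norm (w x) / L \<le> 1" for x
      using DE(6) LE by simp
    then have "modular p (\<lambda>x. w x /\<^sub>R L) \<le> (\<integral>\<^sup>+ x. 0 \<partial>(lebesgue :: (real^'n) measure))"
      unfolding modular_def norm_div using pinf
      by (intro nn_integral_mono_AE) (auto elim!: eventually_mono simp: omega_def)
    then show ?thesis by simp
  next
    case (real a)
    have a: "2 \<le> a" using p2 real by simp
    have pa: "AE x in lebesgue. ereal a \<le> p x"
      using AE_p_minus_le[of p] unfolding real .
    have Lpow: "(\<integral>\<^sup>+ x. ennreal (norm (g x) powr a) \<partial>lebesgue) \<le> ennreal (D + 1)"
      if [measurable]: "g \<in> borel_measurable lebesgue" and g: "modular p g \<le> 1" "(\<integral>\<^sup>+ x. ennreal ((norm (g x))\<^sup>2) \<partial>lebesgue) \<le> ennreal D"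
      for g :: "real^'n \<Rightarrow> complex"
    proof -
      have "(\<integral>\<^sup>+ x. ennreal (norm (g x) powr a) \<partial>lebesgue)
         \<le> (\<integral>\<^sup>+ x. ennreal ((norm (g x))\<^sup>2) + omega (p x) (norm (g x)) \<partial>lebesgue)"
        using pa a by (intro nn_integral_mono_AE) (auto elim!: eventually_mono intro: powr_le_square_plus_omega)
      also have "\<dots> = (\<integral>\<^sup>+ x. ennreal ((norm (g x))\<^sup>2) \<partial>lebesgue) + modular p g"
        unfolding modular_def using p_meas that(1)
        by (intro nn_integral_add borel_measurable_omega) auto
      also have "\<dots> \<le> ennreal D + 1" by (intro add_mono g)
      also have "\<dots> = ennreal (D + 1)" using D by simp
      finally show ?thesis .
    qed
    have fa: "(\<integral>\<^sup>+ y. ennreal (norm (f y) powr (a / 2)) \<partial>lborel) \<le> ennreal ?D"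
    proof -
      have "(\<integral>\<^sup>+ y. ennreal (norm (f y) powr (a / 2)) \<partial>lborel)
         \<le> (\<integral>\<^sup>+ x. ennreal (norm (u x) powr a) \<partial>lebesgue) + (\<integral>\<^sup>+ x. ennreal (norm (v x) powr a) \<partial>lebesgue)"
        using f_powr[of "a / 2"] a by simp
      also have "\<dots> \<le> ennreal (D + 1) + ennreal (D + 1)"
        by (intro add_mono Lpow u v)
      also have "\<dots> = ennreal ?D" using D by (simp add: ennreal_plus[symmetric] del: ennreal_plus)
      finally show ?thesis .
    qed
    \<comment> \<open>For \<open>t \<le> 1\<close> the \<open>a / 2\<close> power of
      \<open>f\<close> gives exactly the exponent \<open>2 / a\<close>. For \<open>t > 1\<close> the
      integrability of \<open>f\<close> gives \<open>t powr - n\<close>, which is stronger than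
      required because \<open>zeta_exp p t \<le> 1\<close>.\<close>
    have w_sup: "norm (w x) \<le> E * t powr (- ?N * zeta_exp p t)" for x
    proof (cases "t \<le> 1")
      case True
      then have "zeta_exp p t = 2 / a" using real a by (simp add: zeta_exp_def)
      moreover have "norm (w x) \<le> (?D + C1) * t powr (- ?N / (a / 2))"
        using eta_majorant_le_Lr[OF t m fb eta1 C1(2) fa] DE C1(2) a by (intro w_le) auto
      moreover have "(?D + C1) * t powr (- ?N / (a / 2)) \<le> E * t powr (- ?N / (a / 2))"
        using DE by (intro mult_right_mono) auto
      ultimately show ?thesis by (simp add: field_simps)
    next
      case False
      have "zeta_exp p t \<le> 1"
      proof (cases "p_plus p")
        case (real b)
        then have "a \<le> b" using p_minus_le_p_plus[of p] \<open>p_minus p = ereal a\<close> by simp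
        then show ?thesis using False a real by (simp add: zeta_exp_def)
      next
        case PInf
        then show ?thesis using False by (simp add: zeta_exp_def)
      next
        case MInf
        then show ?thesis using p_minus_le_p_plus[of p] real by simp
      qed
      then have "?N * zeta_exp p t \<le> ?N * 1" by (intro mult_left_mono) auto
      then have "t powr - ?N \<le> t powr (- ?N * zeta_exp p t)"
        using False by (intro powr_mono) auto
      then have "?D * t powr - ?N \<le> E * t powr (- ?N * zeta_exp p t)"
        using DE by (intro mult_mono) auto
      moreover have "norm (w x) \<le> ?D * t powr - ?N"
        using maj DE by (intro w_le) auto
      ultimately show ?thesis by simp
    qed
    let ?c = "t powr (?N * (a - 1)) / E powr a"
    have pb: "AE x in lebesgue. p x \<le> p_plus p"
      unfolding p_plus_def by (rule esssup_AE)
    have "modular p (\<lambda>x. w x /\<^sub>R L) \<le> (\<integral>\<^sup>+ x. ennreal ?c * ennreal (norm (w x) powr a) \<partial>lebesgue)"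
      unfolding modular_def norm_div
    proof (rule nn_integral_mono_AE)
      show "AE x in lebesgue. omega (p x) (norm (w x) / L) \<le> ennreal ?c * ennreal (norm (w x) powr a)"
        using pa pb
      proof eventually_elim
        case (elim x)
        have \<theta>: "quot (p_minus p) (p_plus p) \<le> quot (ereal a) (p x)" "quot (ereal a) (p x) \<le> 1"
          using elim a unfolding real by (cases "p x"; cases "p_plus p"; simp add: divide_left_mono)+
        have "omega (p x) (norm (w x) / L) \<le> ennreal (?c * norm (w x) powr a)"
        proof (rule omega_interpolate[OF a elim(1) DE(6) t norm_ge_zero w_sup])
          fix \<theta> assume "\<theta> = quot (ereal a) (p x)"
          then show "E * t powr (- ?N * (zeta_exp p t + \<theta> * (1 - 1 / a - zeta_exp p t))) \<le> L"
            unfolding L_def using t_powr_le_sigma_exp[OF real a \<theta> t, of ?N] DE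
            by (intro mult_left_mono) auto
        qed
        then show ?case by (subst (asm) ennreal_mult) auto
      qed
    qed
    also have "\<dots> = ennreal ?c * (\<integral>\<^sup>+ x. ennreal (norm (w x) powr a) \<partial>lebesgue)"
      using wl by (intro nn_integral_cmult) auto
    \<comment> \<open>The bound \<open>w_powr\<close> at \<open>q = a\<close> is the exact
      reciprocal of \<open>?c\<close>, so the modular is at most 1 without further loss.\<close>
    also have "\<dots> \<le> ennreal ?c * ennreal (E powr a * t powr (- ?N * (a - 1)))"
      using a by (intro mult_left_mono w_powr) auto
    also have "\<dots> = 1"
      using DE t by (simp add: ennreal_mult[symmetric] powr_minus)
    finally show ?thesis .
  next
    case MInf
    then show ?thesis using p2 by simp
  qed
  then show "modular p (\<lambda>x. w x /\<^sub>R (E * t powr (- ?N * sigma_exp p t))) \<le> 1"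
    unfolding L_def .
qed

lemma conv_scaleR_product:
  assumes "0 < U" "0 < V"
  shows "conv k (\<lambda>x. (u x /\<^sub>R U) * (v x /\<^sub>R V)) x = conv k (\<lambda>x. u x * v x) x /\<^sub>R (U * V)"
proof -
  have "k (x - y) *\<^sub>R ((u y /\<^sub>R U) * (v y /\<^sub>R V)) = (k (x - y) *\<^sub>R (u y * v y)) /\<^sub>R (U * V)" for y
    by (simp add: mult.commute)
  then show ?thesis
    unfolding conv_def by (simp only: integral_scaleR_right)
qed

text \<open>Removes the normalization: the convolution is bilinear in \<open>u\<close> and
  \<open>v\<close>, so the core estimate for \<open>u\<close> over \<open>U\<close> and
  \<open>v\<close> over \<open>V\<close> is rescaled by \<open>U * V\<close>.\<close>

lemma conv_eta_product:
  fixes p :: "real ^ 'n \<Rightarrow> ereal" and u v :: "real ^ 'n \<Rightarrow> complex"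
  assumes p: "p \<in> var_exponents" and p2: "2 \<le> p_minus p" and m: "0 \<le> m"
    and C1: "(\<integral>\<^sup>+ (x::real^'n). ennreal ((1 + norm x) powr - m) \<partial>lborel) \<le> ennreal C1" "0 \<le> C1"
    and D: "0 \<le> D" and t: "0 < t" and E: "E = 4 * (D + 1) * (1 + C1)"
    and U: "0 < U" and V: "0 < V"
    and u: "u \<in> borel_measurable lebesgue" "modular p (\<lambda>x. u x /\<^sub>R U) \<le> 1"
      "(\<integral>\<^sup>+ x. ennreal ((norm (u x /\<^sub>R U))\<^sup>2) \<partial>lebesgue) \<le> ennreal D"
    and v: "v \<in> borel_measurable lebesgue" "modular p (\<lambda>x. v x /\<^sub>R V) \<le> 1"
      "(\<integral>\<^sup>+ x. ennreal ((norm (v x /\<^sub>R V))\<^sup>2) \<partial>lebesgue) \<le> ennreal D"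
  defines "w \<equiv> conv (eta t m) (\<lambda>x. u x * v x)"
  shows "conv_exists (eta t m) (\<lambda>x. u x * v x)"
    and "w \<in> Lp p" and "Lp_norm p w \<le> E * t powr (- real CARD('n) * sigma_exp p t) * U * V"
    and "w \<in> L2" and "L2_norm w \<le> E * t powr (- real CARD('n) / 2) * U * V"
proof -
  have E0: "0 < E" unfolding E using C1(2) D by (intro mult_pos_pos) auto
  have meas: "(\<lambda>x. u x /\<^sub>R U) \<in> borel_measurable lebesgue" "(\<lambda>x. v x /\<^sub>R V) \<in> borel_measurable lebesgue"
    using u(1) v(1) by simp_all
  let ?w = "conv (eta t m) (\<lambda>x. (u x /\<^sub>R U) * (v x /\<^sub>R V))"
  have w': "?w x = w x /\<^sub>R (U * V)" for x
    unfolding w_def using U V by (rule conv_scaleR_product)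
  note n = conv_eta_product_normalized[OF p p2 m C1 D t E meas(1) u(2,3) meas(2) v(2,3)]
  have "integrable lebesgue (\<lambda>y. eta t m (x - y) *\<^sub>R (u y * v y))" for x
  proof -
    have "eta t m (x - y) *\<^sub>R (u y * v y) = (U * V) *\<^sub>R (eta t m (x - y) *\<^sub>R ((u y /\<^sub>R U) * (v y /\<^sub>R V)))" for y
    proof -
      have "U * (V * (inverse V * inverse U)) = 1" using U V by (simp add: field_simps)
      then show ?thesis by simp
    qed
    then show ?thesis
      using integrable_scaleR_right[OF n(1), of "U * V" x] by (simp only:)
  qed
  then show "conv_exists (eta t m) (\<lambda>x. u x * v x)"
    by (simp add: conv_exists_def)
  have "w = (\<lambda>x. (U * V) *\<^sub>R ?w x)"
  proof (rule ext)
    show "w x = (U * V) *\<^sub>R ?w x" for x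
    proof -
      have "U * V * (inverse U * inverse V) = 1" using U V by (simp add: field_simps)
      then show ?thesis unfolding w' by simp
    qed
  qed
  then have wm: "w \<in> borel_measurable lebesgue"
    using n(2) by simp
  let ?S = "E * t powr (- real CARD('n) * sigma_exp p t)"
  have "modular p (\<lambda>x. w x /\<^sub>R (?S * U * V)) \<le> 1"
    using n(3) unfolding w' by (simp add: mult_ac)
  moreover have "0 < ?S * U * V" using E0 t U V by simp
  ultimately show "w \<in> Lp p" "Lp_norm p w \<le> ?S * U * V"
    using wm by (auto intro: Lp_memI Lp_norm_le)
  let ?R = "E * t powr (- real CARD('n) / 2)"
  have "(\<integral>\<^sup>+ x. ennreal ((norm (w x))\<^sup>2) \<partial>lebesgue)
      = (\<integral>\<^sup>+ x. ennreal ((U * V)\<^sup>2) * ennreal ((norm (?w x))\<^sup>2) \<partial>lebesgue)"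
    unfolding w' using U V
    by (intro nn_integral_cong) (simp add: ennreal_mult[symmetric] power_mult_distrib field_simps)
  also have "\<dots> = ennreal ((U * V)\<^sup>2) * (\<integral>\<^sup>+ x. ennreal ((norm (?w x))\<^sup>2) \<partial>lebesgue)"
    using n(2) by (intro nn_integral_cmult) simp
  also have "\<dots> \<le> ennreal ((U * V)\<^sup>2) * ennreal (?R\<^sup>2)"
    by (intro mult_left_mono n(4)) simp
  also have "\<dots> = ennreal ((?R * U * V)\<^sup>2)"
    by (simp add: ennreal_mult[symmetric] power_mult_distrib mult_ac)
  finally have l2: "(\<integral>\<^sup>+ x. ennreal ((norm (w x))\<^sup>2) \<partial>lebesgue) \<le> ennreal ((?R * U * V)\<^sup>2)" .
  have "0 \<le> ?R * U * V" using E0 U V by simp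
  from L2_memI[OF wm this l2] show "w \<in> L2" "L2_norm w \<le> ?R * U * V" .
qed

section \<open>Embedding into the square-integrable functions\<close>

text \<open>The decay condition holds around some unknown constant \<open>g\<close>. Its right side
  tends to 0, so \<open>1 / p x\<close> tends to \<open>g\<close>, and \<open>p_infty p = 2\<close>
  identifies it.\<close>

lemma log_exponents_decay:
  fixes p :: "real ^ 'n \<Rightarrow> ereal"
  assumes p: "p \<in> log_exponents" and p_inf: "p_infty p = 2"
  shows "\<exists>c>0. \<forall>x. \<bar>quot 1 (p x) - 1 / 2\<bar> \<le> c / ln (exp 1 + norm x)"
proof -
  obtain c g where c: "0 < c" and g: "\<And>x. \<bar>quot 1 (p x) - g\<bar> \<le> c / ln (exp 1 + norm x)"
    using p unfolding log_exponents_def globally_log_Hoelder_def by auto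
  have "((\<lambda>x::real^'n. c / ln (exp 1 + norm x)) \<longlongrightarrow> 0) at_infinity"
  proof -
    have "filterlim (\<lambda>x::real^'n. exp 1 + norm x) at_top at_infinity"
      by (intro filterlim_tendsto_add_at_top[OF tendsto_const] filterlim_norm_at_top)
    then have "filterlim (\<lambda>x::real^'n. ln (exp 1 + norm x)) at_infinity at_infinity"
      by (intro filterlim_at_top_imp_at_infinity filterlim_compose[OF ln_at_top])
    then show ?thesis
      by (intro tendsto_divide_0[OF tendsto_const])
  qed
  then have "((\<lambda>x. quot 1 (p x) - g) \<longlongrightarrow> 0) at_infinity"
    by (rule Lim_null_comparison[rotated]) (use g in simp)
  then have "((\<lambda>x. ereal (quot 1 (p x))) \<longlongrightarrow> ereal g) at_infinity"
    by (simp add: LIM_zero_iff)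
  moreover have "ereal (quot 1 (p x)) = 1 / p x" for x
  proof -
    have "1 \<le> p x" using p by (simp add: log_exponents_def var_exponents_def)
    then show ?thesis
      by (cases "p x") (auto simp: one_ereal_def)
  qed
  ultimately have "((\<lambda>x. 1 / p x) \<longlongrightarrow> ereal g) at_infinity"
    by simp
  then have "Lim at_infinity (\<lambda>x. 1 / p x) = ereal g"
    by (rule tendsto_Lim[OF trivial_limit_at_infinity])
  then have "1 / ereal g = 2"
    using p_inf by (simp add: p_infty_def)
  then have g2: "g = 1 / 2"
    \<comment> \<open>If \<open>g\<close> were 0, the quotient in \<open>ereal\<close> would be
      infinite and not 2.\<close>
    by (cases "g = 0") (auto simp: one_ereal_def numeral_eq_ereal field_simps)
  show ?thesis using c g[unfolded g2] by auto
qed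

text \<open>If \<open>R\<^bsup>-m\<^esup> < s\<^sup>2 \<le> 1\<close> and \<open>q < 4\<close>, then \<open>s\<^bsup>2 - q\<^esup>\<close> is at most \<open>R\<^bsup>m (q - 2) / 2\<^esup>\<close>, whose logarithm is
  bounded by the decay of \<open>1 / 2 - 1 / q\<close>; the decay confines \<open>q \<ge> 4\<close> to bounded \<open>R\<close>.\<close>

lemma square_le_omega_plus_powr:
  assumes q: "2 \<le> q" and R: "exp 1 \<le> R" and c: "1 / 2 - quot 1 q \<le> c / ln R"
    and m: "0 \<le> m" and c0: "0 \<le> c" and s: "0 \<le> s"
  shows "ennreal (s\<^sup>2) \<le> ennreal (exp (4 * m * c)) * (omega q s + ennreal (R powr - m))"
proof -
  \<comment> \<open>Both ranges of \<open>q\<close> lead to \<open>4 * c\<close>: for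
    \<open>q \<ge> 4\<close> the decay gives \<open>ln R \<le> 4 * c\<close>, and for
    \<open>q = r < 4\<close> it gives \<open>ln R * (r - 2) / 2 \<le> c * r \<le> 4 * c\<close>.
    Multiplying by \<open>m\<close> and exponentiating yields this constant.\<close>
  let ?K = "exp (4 * m * c)"
  have K: "1 \<le> ?K" using m c0 by simp
  have R0: "0 < R" using R by (rule less_le_trans[OF exp_gt_zero])
  define L where "L = ln R"
  have L: "1 \<le> L" using R R0 by (simp add: L_def ln_ge_iff)
  have Rm: "R powr - m = exp (- m * L)" using R0 by (simp add: powr_def L_def)
  have via_omega: ?thesis if "ennreal (s\<^sup>2) \<le> ennreal ?K * omega q s"
    using that by (rule order_trans) (intro mult_left_mono, auto)
  have via_tail: ?thesis if "s\<^sup>2 \<le> ?K * R powr - m"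
  proof -
    have "ennreal (s\<^sup>2) \<le> ennreal ?K * ennreal (R powr - m)"
      using that by (simp add: ennreal_mult[symmetric] ennreal_leI)
    then show ?thesis by (rule order_trans) (intro mult_left_mono, auto)
  qed
  show ?thesis
  proof (cases "1 < s")
    case True
    have "ennreal (s\<^sup>2) \<le> omega q s"
    proof (cases q)
      case (real r)
      then have "s powr 2 \<le> s powr r" using q True by (intro powr_mono) auto
      then show ?thesis using real True by (simp add: omega_def ennreal_leI)
    qed (use q True in \<open>auto simp: omega_def\<close>)
    also have "\<dots> \<le> ennreal ?K * omega q s"
      using K mult_right_mono[of 1 "ennreal ?K" "omega q s"] by simp
    finally show ?thesis by (rule via_omega)
  next
    case False
    then have s1: "s\<^sup>2 \<le> 1" using s by (simp add: power_le_one)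
    show ?thesis
    proof (cases "4 \<le> q")
      case True
      then have "quot 1 q \<le> 1 / 4"
        by (cases q) (auto simp: field_simps)
      then have "1 / 4 \<le> c / L" using c unfolding L_def by linarith
      then have "L \<le> 4 * c" using L by (simp add: field_simps)
      then have "m * L \<le> m * (4 * c)" using m by (rule mult_left_mono)
      then have "1 \<le> ?K * R powr - m"
        unfolding Rm by (simp add: exp_add[symmetric])
      with s1 have "s\<^sup>2 \<le> ?K * R powr - m" by linarith
      then show ?thesis by (rule via_tail)
    next
      case False
      then obtain r where r: "q = ereal r" "2 \<le> r" "r < 4"
        using q by (cases q) auto
      show ?thesis
      proof (cases "s\<^sup>2 \<le> R powr - m")
        case True
        moreover have "R powr - m \<le> ?K * R powr - m"
          using mult_right_mono[OF K, of "R powr - m"] by simp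
        ultimately have "s\<^sup>2 \<le> ?K * R powr - m" by linarith
        then show ?thesis by (rule via_tail)
      next
        case big: False
        then have s0: "0 < s" using s by (cases "s = 0") auto
        have "exp (- m * L) \<le> s\<^sup>2" using big Rm by simp
        then have "- m * L \<le> ln (s\<^sup>2)" using s0 by (subst ln_ge_iff) auto
        then have lns: "- 2 * ln s \<le> m * L" using s0 by (simp add: ln_realpow)
        have "1 / 2 - 1 / r \<le> c / L" using c r by (simp add: L_def)
        then have "(1 / 2 - 1 / r) * (L * r) \<le> c / L * (L * r)"
          using L r by (intro mult_right_mono) auto
        moreover have "(1 / 2 - 1 / r) * (L * r) = L * (r - 2) / 2"
          using r by (simp add: field_simps)
        moreover have "c / L * (L * r) = c * r"
          using L by simp
        moreover have "c * r \<le> c * 4" using c0 r by (intro mult_left_mono) auto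
        ultimately have "L * (r - 2) / 2 \<le> 4 * c" by linarith
        then have "m * (L * (r - 2) / 2) \<le> m * (4 * c)" using m by (rule mult_left_mono)
        moreover have "- 2 * ln s * ((r - 2) / 2) \<le> m * L * ((r - 2) / 2)"
          using lns r by (intro mult_right_mono) auto
        moreover have "m * (L * (r - 2) / 2) = m * L * ((r - 2) / 2)" by simp
        moreover have "- 2 * ln s * ((r - 2) / 2) = 2 * ln s - r * ln s"
          by (simp add: algebra_simps diff_divide_distrib)
        moreover have "m * (4 * c) = 4 * m * c" by simp
        ultimately have "2 * ln s \<le> 4 * m * c + r * ln s" by linarith
        then have "exp (2 * ln s) \<le> exp (4 * m * c) * exp (r * ln s)"
          unfolding exp_add[symmetric] by simp
        moreover have "exp (2 * ln s) = s\<^sup>2"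
          using s0 powr_numeral[of s] by (simp add: powr_def)
        moreover have "exp (r * ln s) = s powr r"
          using s0 by (simp add: powr_def)
        ultimately have "ennreal (s\<^sup>2) \<le> ennreal ?K * omega q s"
          using r by (simp add: omega_def ennreal_mult[symmetric] ennreal_leI)
        then show ?thesis by (rule via_omega)
      qed
    qed
  qed
qed

text \<open>Integrate \<open>square_le_omega_plus_powr\<close> with
  \<open>R = exp 1 + norm x\<close>. The first term contributes the modular, and the tail is
  dominated by the integrand whose integral is bounded by \<open>C1\<close>.\<close>

lemma nn_integral_square_le_if_modular_le_1:
  fixes p :: "real ^ 'n \<Rightarrow> ereal"
  assumes p: "p \<in> log_exponents" and p2: "2 \<le> p_minus p" and p_inf: "p_infty p = 2" and m: "0 \<le> m"
    and C1: "(\<integral>\<^sup>+ (x::real^'n). ennreal ((1 + norm x) powr - m) \<partial>lborel) \<le> ennreal C1" "0 \<le> C1"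
  shows "\<exists>D\<ge>0. \<forall>f \<in> borel_measurable lebesgue. modular p f \<le> 1 \<longrightarrow>
           (\<integral>\<^sup>+ x. ennreal ((norm (f x))\<^sup>2) \<partial>lebesgue) \<le> ennreal D"
proof -
  obtain c where c: "0 < c" "\<And>x. \<bar>quot 1 (p x) - 1 / 2\<bar> \<le> c / ln (exp 1 + norm x)"
    using log_exponents_decay[OF p p_inf] by auto
  have pv: "p \<in> var_exponents" using p by (simp add: log_exponents_def)
  let ?K = "exp (4 * m * c)"
  let ?R = "\<lambda>x::real^'n. exp 1 + norm x"
  have "(\<integral>\<^sup>+ x. ennreal ((norm (f x))\<^sup>2) \<partial>lebesgue) \<le> ennreal (?K * (1 + C1))"
    if f: "f \<in> borel_measurable lebesgue" "modular p f \<le> 1" for f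
  proof -
    have "(\<lambda>x. ennreal ((1 + norm x) powr - m)) \<in> borel_measurable (lborel :: (real^'n) measure)"
      by measurable
    then have km: "(\<lambda>x::real^'n. ennreal ((1 + norm x) powr - m)) \<in> borel_measurable lebesgue"
      by (rule measurable_completion)
    have om: "(\<lambda>x. omega (p x) (norm (f x))) \<in> borel_measurable lebesgue"
      using var_exponents_measurable[OF pv] f(1) by (intro borel_measurable_omega) auto
    have "(\<integral>\<^sup>+ x. ennreal ((norm (f x))\<^sup>2) \<partial>lebesgue)
       \<le> (\<integral>\<^sup>+ x. ennreal ?K * (omega (p x) (norm (f x)) + ennreal ((1 + norm x) powr - m)) \<partial>lebesgue)"
    proof (rule nn_integral_mono_AE)
      show "AE x in lebesgue. ennreal ((norm (f x))\<^sup>2)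
          \<le> ennreal ?K * (omega (p x) (norm (f x)) + ennreal ((1 + norm x) powr - m))"
        using AE_p_minus_le[of p]
      proof eventually_elim
        case (elim x)
        have "ennreal ((norm (f x))\<^sup>2) \<le> ennreal ?K * (omega (p x) (norm (f x)) + ennreal (?R x powr - m))"
        proof (rule square_le_omega_plus_powr)
          show "2 \<le> p x" using p2 elim by (rule order_trans)
          show "1 / 2 - quot 1 (p x) \<le> c / ln (?R x)" using c(2)[of x] by linarith
        qed (use m c in auto)
        also have "\<dots> \<le> ennreal ?K * (omega (p x) (norm (f x)) + ennreal ((1 + norm x) powr - m))"
        proof -
          have "?R x powr - m \<le> (1 + norm x) powr - m"
            using m exp_ge_add_one_self[of 1] by (intro powr_mono2') (auto intro: add_pos_nonneg)
          then show ?thesis by (intro mult_left_mono add_left_mono ennreal_leI) auto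
        qed
        finally show ?case .
      qed
    qed
    also have "\<dots> = ennreal ?K * (modular p f + (\<integral>\<^sup>+ (x::real^'n). ennreal ((1 + norm x) powr - m) \<partial>lebesgue))"
      unfolding modular_def nn_integral_add[OF om km, symmetric]
      using om km by (intro nn_integral_cmult) simp
    also have "\<dots> \<le> ennreal ?K * (1 + ennreal C1)"
      using C1(1) f(2) by (intro mult_left_mono add_mono) (simp_all add: nn_integral_completion)
    also have "\<dots> = ennreal (?K * (1 + C1))"
      using C1(2) by (simp add: ennreal_mult)
    finally show ?thesis .
  qed
  then show ?thesis
    using C1(2) by (intro exI[of _ "?K * (1 + C1)"]) auto
qed

section \<open>The estimate\<close>

text \<open>With \<open>p_minus p = 2\<close> the condition for \<open>t \<le> 1\<close> always
  holds, \<open>1 - 1 / 2\<close> is \<open>1 / 2\<close>, and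
  \<open>1 / 2 > quot 2 (p_plus p)\<close> means \<open>p_plus p > 4\<close>.\<close>

lemma sigma_exp_eq_K_exp:
  assumes "p_minus p = 2"
  shows "sigma_exp p t = K_exp p t"
proof -
  have p2: "p_minus p = ereal 2" using assms by (simp add: numeral_eq_ereal)
  have q: "quot 1 (p_minus p) = 1 / 2" unfolding p2 by simp
  have "1 / 2 > quot 2 (p_plus p) \<longleftrightarrow> p_plus p > 4" "quot 2 (p_plus p) = 2 * quot 1 (p_plus p)"
    using p_minus_le_p_plus[of p] unfolding p2 by (cases "p_plus p"; auto simp: field_simps)+
  then show ?thesis
    unfolding sigma_exp_def K_exp_def q by (simp add: assms)
qed

text \<open>Existence of the convolution and membership in the spaces are asserted along with the
  norm bounds, which alone would say little where an integral or infimum takes a default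
  value.\<close>

theorem lemma3p13:
  fixes p :: "real ^ 'n \<Rightarrow> ereal" and m :: real
  assumes "p \<in> var_exponents"
    and "2 \<le> p_minus p"
    and "real CARD('n) < m"
  shows "(\<exists>C>0. \<forall>t>0. \<forall>u \<in> Lp p \<inter> L2. \<forall>v \<in> Lp p \<inter> L2.
            conv_exists (eta t m) (\<lambda>x. u x * v x) \<and>
            conv (eta t m) (\<lambda>x. u x * v x) \<in> Lp p \<inter> L2 \<and>
            Lp_L2_norm p (conv (eta t m) (\<lambda>x. u x * v x))
              \<le> C * max (t powr (- real CARD('n) * sigma_exp p t)) (t powr (- real CARD('n) / 2))
                  * Lp_L2_norm p u * Lp_L2_norm p v) \<and>
         (p \<in> log_exponents \<and> p_minus p = 2 \<and> p_infty p = 2 \<longrightarrow>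
           (\<exists>C>0. \<forall>t>0. \<forall>u \<in> Lp p. \<forall>v \<in> Lp p.
              conv_exists (eta t m) (\<lambda>x. u x * v x) \<and>
              conv (eta t m) (\<lambda>x. u x * v x) \<in> Lp p \<and>
              Lp_norm p (conv (eta t m) (\<lambda>x. u x * v x))
                \<le> C * t powr (- real CARD('n) * K_exp p t) * Lp_norm p u * Lp_norm p v))"
proof -
  note p = assms(1) and p2 = assms(2)
  have m: "0 \<le> m" using assms(3) by (rule order_trans[OF of_nat_0_le_iff less_imp_le])
  define C1 where "C1 = enn2real (\<integral>\<^sup>+ (x::real^'n). ennreal ((1 + norm x) powr - m) \<partial>lborel)"
  have "(\<integral>\<^sup>+ (x::real^'n). ennreal ((1 + norm x) powr - m) \<partial>lborel) < \<infinity>"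
    using assms(3) by (intro nn_integral_one_plus_norm_powr_finite) simp
  then have C1: "(\<integral>\<^sup>+ (x::real^'n). ennreal ((1 + norm x) powr - m) \<partial>lborel) \<le> ennreal C1" "0 \<le> C1"
    by (simp_all add: C1_def)
  have LpD: "f \<in> borel_measurable lebesgue" if "f \<in> Lp p" for f
    using that by (simp add: Lp_def)
  show ?thesis
  proof (intro conjI impI)
    \<comment> \<open>The core constant with \<open>D = 1\<close>, since here the intersection norm
      controls the square norm directly.\<close>
    define E where "E = 4 * (1 + 1) * (1 + C1)"
    have E0: "0 < E" using C1(2) by (simp add: E_def)
    show "\<exists>C>0. \<forall>t>0. \<forall>u \<in> Lp p \<inter> L2. \<forall>v \<in> Lp p \<inter> L2.
            conv_exists (eta t m) (\<lambda>x. u x * v x) \<and>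
            conv (eta t m) (\<lambda>x. u x * v x) \<in> Lp p \<inter> L2 \<and>
            Lp_L2_norm p (conv (eta t m) (\<lambda>x. u x * v x))
              \<le> C * max (t powr (- real CARD('n) * sigma_exp p t)) (t powr (- real CARD('n) / 2))
                  * Lp_L2_norm p u * Lp_L2_norm p v"
    proof (intro exI[of _ E] conjI E0 allI impI ballI)
      fix t :: real and u v assume t: "0 < t" and u: "u \<in> Lp p \<inter> L2" and v: "v \<in> Lp p \<inter> L2"
      let ?w = "conv (eta t m) (\<lambda>x. u x * v x)"
      let ?M = "max (t powr (- real CARD('n) * sigma_exp p t)) (t powr (- real CARD('n) / 2))"
      have norm: "0 < U" "modular p (\<lambda>x. f x /\<^sub>R U) \<le> 1"
        "(\<integral>\<^sup>+ x. ennreal ((norm (f x /\<^sub>R U))\<^sup>2) \<partial>lebesgue) \<le> ennreal 1"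
        if "f \<in> Lp p \<inter> L2" "Lp_L2_norm p f < U" for f U
        using that Lp_norm_nonneg[OF p, of f] modular_le_1_if_Lp_norm_less[OF p, of f U]
          nn_integral_le_1_if_L2_norm_less[of f U]
        by (auto simp: Lp_L2_norm_def)
      have main: "conv_exists (eta t m) (\<lambda>x. u x * v x) \<and> ?w \<in> Lp p \<inter> L2 \<and> Lp_L2_norm p ?w \<le> E * ?M * U * V"
        if U: "Lp_L2_norm p u < U" and V: "Lp_L2_norm p v < V" for U V
      proof -
        note n = norm[OF u U] norm[OF v V]
        note w = conv_eta_product[OF p p2 m C1 zero_le_one t E_def n(1) n(4) LpD n(2,3) LpD n(5,6)]
        have "E * t powr (- real CARD('n) * sigma_exp p t) * U * V \<le> E * ?M * U * V"
          "E * t powr (- real CARD('n) / 2) * U * V \<le> E * ?M * U * V"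
          using E0 n(1,4) by (auto intro!: mult_right_mono mult_left_mono)
        with w show ?thesis using u v unfolding Lp_L2_norm_def by auto
      qed
      \<comment> \<open>Neither claim involves \<open>U\<close> or \<open>V\<close>, so any numbers
        above the two norms will do.\<close>
      show "conv_exists (eta t m) (\<lambda>x. u x * v x)" "?w \<in> Lp p \<inter> L2"
        using main[OF less_add_one less_add_one] by simp_all
      show "Lp_L2_norm p ?w \<le> E * ?M * Lp_L2_norm p u * Lp_L2_norm p v"
        by (rule le_mult_of_greater) (use main in simp)
    qed
  next
    assume "p \<in> log_exponents \<and> p_minus p = 2 \<and> p_infty p = 2"
    then have pl: "p \<in> log_exponents" "p_minus p = 2" "p_infty p = 2" by simp_all
    \<comment> \<open>Only the modular is controlled now; the embedding supplies the missing square
      bound, with \<open>D\<close> fixed before \<open>t\<close>, \<open>u\<close> and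
      \<open>v\<close>.\<close>
    obtain D where D: "0 \<le> D" and
      L2: "\<And>f. f \<in> borel_measurable lebesgue \<Longrightarrow> modular p f \<le> 1 \<Longrightarrow>
           (\<integral>\<^sup>+ x. ennreal ((norm (f x))\<^sup>2) \<partial>lebesgue) \<le> ennreal D"
      using nn_integral_square_le_if_modular_le_1[OF pl(1) p2 pl(3) m C1] by auto
    define E where "E = 4 * (D + 1) * (1 + C1)"
    have E0: "0 < E" using C1(2) D by (simp add: E_def)
    show "\<exists>C>0. \<forall>t>0. \<forall>u \<in> Lp p. \<forall>v \<in> Lp p.
              conv_exists (eta t m) (\<lambda>x. u x * v x) \<and>
              conv (eta t m) (\<lambda>x. u x * v x) \<in> Lp p \<and>
              Lp_norm p (conv (eta t m) (\<lambda>x. u x * v x))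
                \<le> C * t powr (- real CARD('n) * K_exp p t) * Lp_norm p u * Lp_norm p v"
    proof (intro exI[of _ E] conjI E0 allI impI ballI)
      fix t :: real and u v assume t: "0 < t" and u: "u \<in> Lp p" and v: "v \<in> Lp p"
      let ?w = "conv (eta t m) (\<lambda>x. u x * v x)"
      have norm: "0 < U" "modular p (\<lambda>x. f x /\<^sub>R U) \<le> 1"
        "(\<integral>\<^sup>+ x. ennreal ((norm (f x /\<^sub>R U))\<^sup>2) \<partial>lebesgue) \<le> ennreal D"
        if f: "f \<in> Lp p" and U: "Lp_norm p f < U" for f U
      proof -
        show "0 < U" using Lp_norm_nonneg[OF p f] U by linarith
        show mod: "modular p (\<lambda>x. f x /\<^sub>R U) \<le> 1"
          by (rule modular_le_1_if_Lp_norm_less[OF p f U])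
        show "(\<integral>\<^sup>+ x. ennreal ((norm (f x /\<^sub>R U))\<^sup>2) \<partial>lebesgue) \<le> ennreal D"
          using LpD[OF f] by (intro L2[OF _ mod]) simp
      qed
      have main: "conv_exists (eta t m) (\<lambda>x. u x * v x) \<and> ?w \<in> Lp p \<and>
          Lp_norm p ?w \<le> E * t powr (- real CARD('n) * K_exp p t) * U * V"
        if U: "Lp_norm p u < U" and V: "Lp_norm p v < V" for U V
      proof -
        note n = norm[OF u U] norm[OF v V]
        show ?thesis
          using conv_eta_product[OF p p2 m C1 D t E_def n(1) n(4) LpD[OF u] n(2,3) LpD[OF v] n(5,6)]
          unfolding sigma_exp_eq_K_exp[OF pl(2)] by simp
      qed
      show "conv_exists (eta t m) (\<lambda>x. u x * v x)" "?w \<in> Lp p"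
        using main[OF less_add_one less_add_one] by simp_all
      show "Lp_norm p ?w \<le> E * t powr (- real CARD('n) * K_exp p t) * Lp_norm p u * Lp_norm p v"
        by (rule le_mult_of_greater) (use main in simp)
    qed
  qed
qed

end
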